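(* Let $\mathbb{K}$ be a field and let $R$ be a reduced standard graded $\mathbb{K}$-algebra with $\mathrm{depth}(R)\ge 2$. Then for every integer $\ell\ge 1$, $$r_R(\ell+1)\ \le\ r_R(\ell)+1,$$ where $r_R(\ell)$ is the regularity index of the generalized minimum distance function of $R$.
   Context: A standard graded $\mathbb{K}$-algebra is a (commutative, Noetherian) graded ring $R=\bigoplus_{t\ge 0}R_t$ with $R_0=\mathbb{K}$, generated as a $\mathbb{K}$-algebra by finitely many elements of $R_1$. Put $d=\dim(R)$; depth is taken with respect to the homogeneous maximal ideal $\mathfrak{m}=\bigoplus_{t\geq 1}R_t$. For a finitely generated graded $R$-module $M$, let $h_M(i)=\dim_{\mathbb{K}}[M]_i$ and let $$\mathrm{e}(M)=\lim_{t\to\infty}\frac{d!\,\sum_{i\le t}h_M(i)}{t^{d}}$$ be its Hilbert-Samuel multiplicity as an $R$-module (so $\mathrm{e}(M)=0$ if $\dim(M)<d$). For integers $t\ge 0$ and $\ell\ge 1$, let $\mathcal{F}_{t,\ell}$ be the collection of sets $F=\{f_1,\ldots,f_\ell\}\subseteq R_t$ such that $f_1,\ldots,f_\ell$ are $\mathbb{K}$-linearly independent and $\mathrm{Ann}_R(F)=\{r\in R\mid rf_i=0\text{ for all }i\}\neq 0$. The generalized minimum distance function of $R$ is $$\delta_R(t,\ell)=\begin{cases}\mathrm{e}(R)-\max\{\mathrm{e}(R/(F))\mid F\in\mathcal{F}_{t,\ell}\}&\text{if }\mathcal{F}_{t,\ell}\neq\varnothing,\\ \mathrm{e}(R)&\text{if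 }\mathcal{F}_{t,\ell}=\varnothing.\end{cases}$$ (For $t=0$ one always has $\mathcal{F}_{0,\ell}=\varnothing$ and $\delta_R(0,\ell)=\mathrm{e}(R)$.) For reduced $R$ and fixed $\ell$, the function $t\mapsto\delta_R(t,\ell)$ is non-increasing and eventually constant. The stabilization value is $s_R(\ell)=\lim_{t\to\infty}\delta_R(t,\ell)$, and the regularity index is $$r_R(\ell)=\min\{t\in\mathbb{N}\mid \delta_R(t,\ell)=s_R(\ell)\},\qquad \mathbb{N}=\{0,1,2,\ldots\}.$$ *)

theory Defs
  imports Complex_Main "HOL-Library.Extended_Nat"
begin

section \<open>Ideals of a commutative ring\<close>

text \<open>A commutative ring is a module over itself via multiplication; its submodules are the
  ideals, and spans are the generated ideals.\<close>

lemma module_times: "module ((*) :: 'r::comm_ring_1 \<Rightarrow> 'r \<Rightarrow> 'r)"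
  by unfold_locales (simp_all add: algebra_simps)

abbreviation is_ideal :: "'r::comm_ring_1 set \<Rightarrow> bool"
  where "is_ideal \<equiv> module.subspace (*)"

abbreviation ideal_gen :: "'r::comm_ring_1 set \<Rightarrow> 'r set"
  where "ideal_gen \<equiv> module.span (*)"

definition is_prime_ideal :: "'r::comm_ring_1 set \<Rightarrow> bool"
  where "is_prime_ideal P \<longleftrightarrow>
    is_ideal P \<and> P \<noteq> UNIV \<and> (\<forall>a b. a * b \<in> P \<longrightarrow> a \<in> P \<or> b \<in> P)"

definition krull_dim :: "'r::comm_ring_1 itself \<Rightarrow> enat"
  where "krull_dim _ = Sup {enat n | n. \<exists>P :: nat \<Rightarrow> 'r set.
    (\<forall>i\<le>n. is_prime_ideal (P i)) \<and> (\<forall>i<n. P i \<subset> P (Suc i))}"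

definition regular_sequence :: "'r::comm_ring_1 list \<Rightarrow> bool"
  where "regular_sequence xs \<longleftrightarrow>
    (\<forall>i<length xs. \<forall>r. r * xs ! i \<in> ideal_gen (set (take i xs))
        \<longrightarrow> r \<in> ideal_gen (set (take i xs))) \<and>
    ideal_gen (set xs) \<noteq> UNIV"

definition depth_wrt :: "'r::comm_ring_1 set \<Rightarrow> enat"
  where "depth_wrt I = Sup {enat (length xs) | xs. regular_sequence xs \<and> set xs \<subseteq> I}"

definition annihilator :: "'r::comm_ring_1 set \<Rightarrow> 'r set"
  where "annihilator F = {r. \<forall>f\<in>F. r * f = 0}"


section \<open>Dimension in a quotient vector space\<close>

text \<open>For a subspace \<open>W\<close> of the ambient space: \<open>B \<subseteq> V\<close>, and the classes modulo \<open>W\<close> of the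
  elements of \<open>B\<close> form a basis of the image \<open>(V + W) / W\<close> of the subspace \<open>V\<close>
  in the quotient by \<open>W\<close>.\<close>

definition basis_modulo ::
    "('k::field \<Rightarrow> 'b::ab_group_add \<Rightarrow> 'b) \<Rightarrow> 'b set \<Rightarrow> 'b set \<Rightarrow> 'b set \<Rightarrow> bool"
  where "basis_modulo scale W V B \<longleftrightarrow>
    B \<subseteq> V \<and>
    (\<forall>S c. finite S \<and> S \<subseteq> B \<and> (\<Sum>b\<in>S. scale (c b) b) \<in> W \<longrightarrow> (\<forall>b\<in>S. c b = 0)) \<and>
    (\<forall>v\<in>V. \<exists>u\<in>module.span scale B. v - u \<in> W)"

definition dim_modulo :: "('k::field \<Rightarrow> 'b::ab_group_add \<Rightarrow> 'b) \<Rightarrow> 'b set \<Rightarrow> 'b set \<Rightarrow> nat"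
  where "dim_modulo scale W V = card (SOME B. basis_modulo scale W V B)"


section \<open>Hilbert-Samuel multiplicity\<close>

text \<open>The multiplicity, as an \<open>'r\<close>-module, of a graded module with Hilbert function \<open>h\<close>; it is
  normalised by the Krull dimension of the ring \<open>'r\<close>, not of the module. That dimension is finite
  for standard graded algebras.\<close>

definition multiplicity :: "'r::comm_ring_1 itself \<Rightarrow> (nat \<Rightarrow> nat) \<Rightarrow> real"
  where "multiplicity _ h = (let d = the_enat (krull_dim TYPE('r)) in
    lim (\<lambda>t. fact d * real (\<Sum>i\<le>t. h i) / real t ^ d))"


section \<open>Standard graded algebras\<close>

text \<open>\<open>R t\<close> is the homogeneous component of degree \<open>t\<close> of the ring \<open>'r\<close>, and \<open>scale\<close> is the
  \<open>'k\<close>-algebra structure.\<close>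

locale standard_graded_algebra =
  vector_space scale for scale :: "'k::field \<Rightarrow> 'r::comm_ring_1 \<Rightarrow> 'r" +
  fixes R :: "nat \<Rightarrow> 'r set"
  assumes scale_mult: "scale a (x * y) = scale a x * y"
    and subspace_component: "subspace (R t)"
    and mult_component: "x \<in> R s \<Longrightarrow> y \<in> R t \<Longrightarrow> x * y \<in> R (s + t)"
    and direct_sum: "\<exists>!f. (\<forall>t. f t \<in> R t) \<and> finite {t. f t \<noteq> 0} \<and> r = (\<Sum>t | f t \<noteq> 0. f t)"
    and component_0: "R 0 = range (\<lambda>a. scale a 1)"
    and generated_in_degree_1:
      "\<exists>S. finite S \<and> S \<subseteq> R 1 \<and>
        (\<lambda>A. subspace A \<and> 1 \<in> A \<and> (\<forall>x\<in>A. \<forall>y\<in>A. x * y \<in> A)) hull S = UNIV"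
    and noetherian: "is_ideal (I :: 'r set) \<Longrightarrow> \<exists>S. finite S \<and> I = ideal_gen S"
begin

definition maximal_ideal :: "'r set"
  where "maximal_ideal = span (\<Union>t\<in>{1..}. R t)"

definition depth :: enat
  where "depth = depth_wrt maximal_ideal"

definition hilbert :: "nat \<Rightarrow> nat"
  where "hilbert i = dim (R i)"

text \<open>The Hilbert function of \<open>R/I\<close> for a homogeneous ideal \<open>I\<close>: the component of degree \<open>i\<close> of
  \<open>R/I\<close> is the image of \<open>R i\<close>.\<close>

definition hilbert_quotient :: "'r set \<Rightarrow> nat \<Rightarrow> nat"
  where "hilbert_quotient I i = dim_modulo scale I (R i)"

definition gen_min_dist_family :: "nat \<Rightarrow> nat \<Rightarrow> 'r set set"
  where "gen_min_dist_family t l = {F. F \<subseteq> R t \<and> finite F \<and> card F = l \<and> independent F \<and>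
    annihilator F \<noteq> {0}}"

text \<open>The set whose maximum is taken is finite even when \<open>gen_min_dist_family t l\<close> is not: multiplicities
  are integers, and those of quotients of \<open>R\<close> lie between \<open>0\<close> and that of \<open>R\<close>.\<close>

definition gen_min_dist :: "nat \<Rightarrow> nat \<Rightarrow> real"
  where "gen_min_dist t l =
    (if gen_min_dist_family t l \<noteq> {}
     then multiplicity TYPE('r) hilbert -
       Max {multiplicity TYPE('r) (hilbert_quotient (ideal_gen F)) | F. F \<in> gen_min_dist_family t l}
     else multiplicity TYPE('r) hilbert)"

definition stab_value :: "nat \<Rightarrow> real"
  where "stab_value l = lim (\<lambda>t. gen_min_dist t l)"

definition reg_index :: "nat \<Rightarrow> nat"
  where "reg_index l = (LEAST t. gen_min_dist t l = stab_value l)"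

end

end

theory Submission
  imports Defs
begin

text \<open>Let \<open>m t l\<close> be the maximum of the multiplicities of \<open>R/(F)\<close> over the admissible families \<open>F\<close>
  (\<open>0\<close> if there are none), so that the generalized minimum distance is \<open>e(R) - m t l\<close>. Dropping an
  element of \<open>F\<close> gives \<open>m t (l + 1) \<le> m t l\<close>. If \<open>V\<close> is the span of \<open>F\<close>, depth at least two forces
  \<open>dim (R 1 * V) > dim V\<close>, so \<open>l + 1\<close> independent elements of \<open>R 1 * V\<close>, which lie in \<open>(F)\<close>, show
  \<open>m t l \<le> m (t + 1) (l + 1)\<close>. Hence \<open>m\<close> is non-decreasing in \<open>t\<close>; being integer valued and bounded
  by \<open>e(R)\<close>, it is eventually constant, with the same limit for \<open>l\<close> and \<open>l + 1\<close>, and once \<open>m t l\<close> has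
  reached this limit so has \<open>m (t + 1) (l + 1)\<close>.

  That multiplicities exist as natural numbers is shown by Noetherian induction on homogeneous ideals
  \<open>I\<close>: if \<open>I\<close> is not prime, the Hilbert function of \<open>R/I\<close> is the sum of those of \<open>R/(I + f)\<close> and
  of a shift of \<open>R/(I : f)\<close>; if \<open>I\<close> is prime and \<open>x \<in> R 1 - I\<close>, it is the sum function of that of
  \<open>R/(I + x)\<close>. The induction also yields a chain of primes as long as the degree of growth.
  Conversely the Krull dimension is finite, as the degree of growth drops along every strict inclusion
  of primes.\<close>

section \<open>Dimensions of subspaces\<close>

text \<open>\<open>dim\<close> takes the default value 0 on spaces without a finite basis, and the
  ring itself is usually infinite-dimensional. This predicate marks the sets on which dimension
  counts are meaningful.\<close>

definition (in vector_space) fin_dim :: "'b set \<Rightarrow> bool"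
  where "fin_dim V \<longleftrightarrow> (\<exists>B. finite B \<and> V \<subseteq> span B)"

context vector_space
begin

lemma fin_dim_subset: "fin_dim V \<Longrightarrow> U \<subseteq> V \<Longrightarrow> fin_dim U"
  unfolding fin_dim_def by blast

lemma fin_dim_span: "finite B \<Longrightarrow> fin_dim (span B)"
  unfolding fin_dim_def by blast

lemma fin_dim_independent_finite:
  assumes "fin_dim V" "B \<subseteq> V" "independent B"
  shows "finite B"
  using assms independent_span_bound unfolding fin_dim_def by (meson subset_trans)

lemma fin_dim_independent_card_le:
  assumes "fin_dim V" "B \<subseteq> V" "independent B"
  shows "card B \<le> dim V"
proof -
  obtain D where "B \<subseteq> D" "D \<subseteq> V" "independent D" "V \<subseteq> span D"
    using maximal_independent_subset_extend assms by metis
  moreover have "finite D"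
    using calculation assms fin_dim_independent_finite by blast
  ultimately show ?thesis
    using basis_card_eq_dim card_mono by metis
qed

lemma fin_dim_dim_mono:
  assumes "fin_dim V" "U \<subseteq> V"
  shows "dim U \<le> dim V"
proof -
  obtain B where "B \<subseteq> U" "independent B" "card B = dim U"
    using basis_exists by metis
  then show ?thesis
    using fin_dim_independent_card_le[of V B] assms by auto
qed

lemma fin_dim_dim_eq:
  assumes "fin_dim V" "subspace U" "U \<subseteq> V" "dim V \<le> dim U"
  shows "U = V"
proof (rule ccontr)
  assume "U \<noteq> V"
  then obtain v where v: "v \<in> V" "v \<notin> U" using assms by auto
  obtain B where B: "B \<subseteq> U" "independent B" "U \<subseteq> span B" "card B = dim U"
    using basis_exists by metis
  have "span B \<subseteq> U" using B assms by (simp add: span_minimal)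
  then have "v \<notin> span B" using v by blast
  then have "independent (insert v B)" "v \<notin> B"
    using independent_insertI[OF _ B(2)] span_base by auto
  moreover have "finite B" using B assms fin_dim_independent_finite by blast
  moreover have "insert v B \<subseteq> V" using v B assms by auto
  ultimately show False
    using fin_dim_independent_card_le[OF assms(1), of "insert v B"] B assms by simp
qed

lemma fin_dim_sums:
  assumes "fin_dim U" "fin_dim W"
  shows "fin_dim {x + y |x y. x \<in> U \<and> y \<in> W}"
proof -
  obtain A B where AB: "finite A" "U \<subseteq> span A" "finite B" "W \<subseteq> span B"
    using assms unfolding fin_dim_def by auto
  have "{x + y |x y. x \<in> U \<and> y \<in> W} \<subseteq> span (A \<union> B)"
    unfolding span_Un using AB by blast
  then show ?thesis unfolding fin_dim_def using AB by blast
qed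

text \<open>The third hypothesis says that the \<open>g a\<close> are independent modulo
  \<open>span C\<close>. Adding one index at a time, a dependence of \<open>g a\<close> on the
  earlier vectors would be a relation with coefficient 1 at \<open>a\<close>.\<close>

lemma independent_Un_image:
  assumes "finite A" "independent C"
    and "\<And>c. (\<Sum>a\<in>A. c a *s g a) \<in> span C \<Longrightarrow> \<forall>a\<in>A. c a = 0"
  shows "independent (C \<union> g ` A) \<and> inj_on g A \<and> C \<inter> g ` A = {}"
  using assms(1,3)
proof (induction A rule: finite_induct)
  case empty
  then show ?case using assms by simp
next
  case (insert a A)
  have IH: "independent (C \<union> g ` A)" "inj_on g A" "C \<inter> g ` A = {}"
  proof -
    have "\<forall>b\<in>A. c b = 0" if "(\<Sum>b\<in>A. c b *s g b) \<in> span C" for c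
    proof -
      \<comment> \<open>Extending a relation over \<open>A\<close> by the coefficient 0 at the new
        index makes the hypothesis for \<open>insert a A\<close> applicable.\<close>
      define c' where "c' = c(a := 0)"
      have "(\<Sum>b\<in>insert a A. c' b *s g b) = (\<Sum>b\<in>A. c b *s g b)"
        using insert.hyps by (auto simp: c'_def intro!: sum.cong)
      then have "\<forall>b\<in>insert a A. c' b = 0" using insert.prems that by metis
      then show ?thesis using insert.hyps by (metis c'_def fun_upd_apply insertCI)
    qed
    then show "independent (C \<union> g ` A)" "inj_on g A" "C \<inter> g ` A = {}"
      using insert.IH by auto
  qed
  have notin: "g a \<notin> span (C \<union> g ` A)"
  proof
    assume "g a \<in> span (C \<union> g ` A)"
    then obtain x y where xy: "g a = x + y" "x \<in> span C" "y \<in> span (g ` A)"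
      unfolding span_Un by blast
    then obtain u where "y = (\<Sum>v\<in>g ` A. u v *s v)"
      using insert.hyps by (auto simp: span_finite)
    then have y: "y = (\<Sum>b\<in>A. u (g b) *s g b)"
      using IH by (simp add: sum.reindex)
    define c where "c b = (if b = a then 1 else - u (g b))" for b
    have "(\<Sum>b\<in>A. c b *s g b) = (\<Sum>b\<in>A. - (u (g b) *s g b))"
      using insert.hyps by (intro sum.cong) (auto simp: c_def)
    then have "(\<Sum>b\<in>insert a A. c b *s g b) = g a - y"
      using insert.hyps y by (simp add: c_def sum_negf)
    also have "\<dots> = x" using xy by simp
    finally have "c a = 0" using insert.prems[of c] xy by simp
    then show False by (simp add: c_def)
  qed
  then have "g a \<notin> C" "g a \<notin> g ` A" by (auto simp: span_base)
  moreover have "independent (insert (g a) (C \<union> g ` A))"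
    using notin IH(1) by (rule independent_insertI)
  ultimately show ?case using IH by auto
qed

text \<open>Rank-nullity for the map that \<open>f\<close> induces from \<open>U\<close> to the
  quotient by \<open>W\<close>: its kernel is \<open>{u \<in> U. f u \<in> W}\<close> and its image
  is the quotient of \<open>W + f U\<close> by \<open>W\<close>. All later dimension counts use it
  with \<open>f\<close> a multiplication or the identity.\<close>

lemma dim_plus_image:
  assumes "Vector_Spaces.linear scale scale f" "subspace U" "subspace W" "fin_dim U" "fin_dim W"
  shows "dim {x + y |x y. x \<in> W \<and> y \<in> f ` U} + dim {u \<in> U. f u \<in> W} = dim W + dim U"
proof -
  interpret f: Vector_Spaces.linear scale scale f by (rule assms)
  define K where "K = {u \<in> U. f u \<in> W}"
  have "K = U \<inter> {u. f u \<in> W}" by (auto simp: K_def)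
  then have K: "subspace K" "K \<subseteq> U"
    using assms f.subspace_linear_preimage by (auto intro: subspace_inter)
  obtain B0 where B0: "B0 \<subseteq> K" "independent B0" "K \<subseteq> span B0" "card B0 = dim K"
    using basis_exists by metis
  have "B0 \<subseteq> U" using B0 K by simp
  then obtain B where B: "B0 \<subseteq> B" "B \<subseteq> U" "independent B" "U \<subseteq> span B"
    using B0(2) by (rule maximal_independent_subset_extend)
  obtain C where C: "C \<subseteq> W" "independent C" "W \<subseteq> span C" "card C = dim W"
    using basis_exists by metis
  have fin: "finite B" "finite C"
    using fin_dim_independent_finite assms B C by blast+
  \<comment> \<open>\<open>A\<close> completes a basis of the kernel to a basis of \<open>U\<close>,
    so its image together with a basis of \<open>W\<close> should be a basis of the sum.\<close>
  define A where "A = B - B0"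
  have BA: "B = A \<union> B0" "A \<inter> B0 = {}" "finite A" "finite B0"
    using B fin by (auto simp: A_def finite_subset)
  have spanC: "span C = W" using C assms by (simp add: span_subspace)
  have spanB: "span B = U" using B assms by (simp add: span_subspace)
  \<comment> \<open>A relation among the \<open>f a\<close> modulo \<open>W\<close> puts the
    combination of the \<open>a\<close> into the kernel, hence into \<open>span B0\<close>; this
    contradicts the independence of \<open>B\<close> unless it is trivial.\<close>
  have *: "\<forall>a\<in>A. c a = 0" if "(\<Sum>a\<in>A. c a *s f a) \<in> span C" for c
  proof -
    let ?u = "\<Sum>a\<in>A. c a *s a"
    have "f ?u = (\<Sum>a\<in>A. c a *s f a)" by (simp add: f.sum f.scale)
    moreover have "?u \<in> U"
      using BA B assms by (intro subspace_sum subspace_scale) auto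
    ultimately have "?u \<in> span B0" using that spanC B0 by (auto simp: K_def)
    then obtain d where d: "?u = (\<Sum>b\<in>B0. d b *s b)"
      using BA by (auto simp: span_finite)
    define e where "e b = (if b \<in> A then c b else - d b)" for b
    have "(\<Sum>b\<in>B. e b *s b) = (\<Sum>b\<in>A. e b *s b) + (\<Sum>b\<in>B0. e b *s b)"
      using BA by (simp add: sum.union_disjoint)
    also have "(\<Sum>b\<in>A. e b *s b) = ?u" by (simp add: e_def)
    also have "(\<Sum>b\<in>B0. e b *s b) = (\<Sum>b\<in>B0. - (d b *s b))"
      using BA by (intro sum.cong) (auto simp: e_def)
    also have "\<dots> = - ?u" using d by (simp add: sum_negf)
    finally have "(\<Sum>b\<in>B. e b *s b) = 0" by simp
    then have "\<forall>b\<in>B. e b = 0" using independentD[OF B(3) fin(1) subset_refl] by blast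
    then show ?thesis using BA(1) by (metis Un_iff e_def)
  qed
  have D: "independent (C \<union> f ` A)" "inj_on f A" "C \<inter> f ` A = {}"
    using independent_Un_image[OF BA(3) C(2), of f] * by auto
  have "span (C \<union> f ` A) = {x + y |x y. x \<in> W \<and> y \<in> f ` U}"
  proof -
    have "span (C \<union> f ` A) \<subseteq> {x + y |x y. x \<in> W \<and> y \<in> f ` U}"
      unfolding span_Un spanC f.span_image
      using BA spanB span_mono[of A B] by blast
    moreover have "{x + y |x y. x \<in> W \<and> y \<in> f ` U} \<subseteq> span (C \<union> f ` A)"
    proof clarify
      fix x u assume xu: "x \<in> W" "u \<in> U"
      have "u \<in> span (A \<union> B0)" using xu spanB BA by auto
      then obtain p q where pq: "u = p + q" "p \<in> span A" "q \<in> span B0"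
        unfolding span_Un by blast
      have "span B0 \<subseteq> K" using B0 K by (simp add: span_minimal)
      then have "f q \<in> W" using pq by (auto simp: K_def)
      then have "x + f q \<in> span C" using xu spanC assms by (auto intro: subspace_add)
      moreover have "f p \<in> span (f ` A)" using pq f.span_image by auto
      ultimately have "(x + f q) + f p \<in> span (C \<union> f ` A)" unfolding span_Un by blast
      then show "x + f u \<in> span (C \<union> f ` A)" using pq by (simp add: f.add algebra_simps)
    qed
    ultimately show ?thesis by auto
  qed
  then have "dim {x + y |x y. x \<in> W \<and> y \<in> f ` U} = card (C \<union> f ` A)"
    using D dim_span_eq_card_independent by metis
  also have "\<dots> = card C + card A"
    using D BA fin by (simp add: card_Un_disjoint card_image)
  finally have "dim {x + y |x y. x \<in> W \<and> y \<in> f ` U} = card C + card A" .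
  moreover have "card B = card A + card B0"
    using BA by (simp add: card_Un_disjoint)
  moreover have "card B = dim U" by (rule basis_card_eq_dim[OF B(2,4,3)])
  ultimately show ?thesis using B0 C by (simp add: K_def)
qed

lemma dim_sums_add_Int:
  assumes "subspace U" "subspace W" "fin_dim U" "fin_dim W"
  shows "dim {x + y |x y. x \<in> W \<and> y \<in> U} + dim (U \<inter> W) = dim W + dim U"
proof -
  have "Vector_Spaces.linear scale scale (\<lambda>x. x)"
    using module_hom_ident by (simp add: module_hom_iff_linear)
  from dim_plus_image[OF this assms] show ?thesis
    by (simp add: Int_def)
qed

text \<open>Joined with a basis of \<open>V \<inter> W\<close>, a basis modulo \<open>W\<close>
  becomes a basis of \<open>V\<close>. Hence all bases modulo \<open>W\<close> have the same size,
  and the choice in \<open>dim_modulo\<close> is harmless.\<close>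

lemma basis_modulo_card:
  assumes "subspace V" "subspace W" "fin_dim V" "basis_modulo scale W V B"
  shows "card B + dim (V \<inter> W) = dim V"
proof -
  have B: "B \<subseteq> V" "\<And>S c. finite S \<Longrightarrow> S \<subseteq> B \<Longrightarrow> (\<Sum>b\<in>S. c b *s b) \<in> W \<Longrightarrow> \<forall>b\<in>S. c b = 0"
    "\<And>v. v \<in> V \<Longrightarrow> \<exists>u\<in>span B. v - u \<in> W"
    using assms(4) unfolding basis_modulo_def by blast+
  have "independent B"
    unfolding independent_explicit_finite_subsets
    by (auto dest!: B(2) simp: subspace_0[OF assms(2)])
  then have finB: "finite B" using B assms fin_dim_independent_finite by blast
  obtain C where C: "C \<subseteq> V \<inter> W" "independent C" "V \<inter> W \<subseteq> span C" "card C = dim (V \<inter> W)"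
    using basis_exists by metis
  have spanC: "span C = V \<inter> W" using C assms by (simp add: span_subspace subspace_inter)
  have finC: "finite C" using C assms fin_dim_independent_finite by blast
  have D: "independent (C \<union> B)" "C \<inter> B = {}"
    using independent_Un_image[OF finB C(2), of "\<lambda>x. x"] B(2)[OF finB] spanC by auto
  have "V \<subseteq> span (C \<union> B)"
  proof
    fix v assume v: "v \<in> V"
    then obtain u where u: "u \<in> span B" "v - u \<in> W" using B by blast
    have "span B \<subseteq> V" using B(1) assms(1) by (rule span_minimal)
    then have "u \<in> V" using u by auto
    then have "v - u \<in> span C" using u v spanC assms by (auto intro: subspace_diff)
    then have "(v - u) + u \<in> span (C \<union> B)" unfolding span_Un using u by blast
    then show "v \<in> span (C \<union> B)" by simp
  qed
  then have "card (C \<union> B) = dim V"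
    using D B C by (intro basis_card_eq_dim) auto
  then show ?thesis using C D finB finC by (simp add: card_Un_disjoint)
qed

text \<open>Extend a basis of \<open>V \<inter> W\<close> to one of \<open>V\<close>; the added
  vectors form a basis modulo \<open>W\<close>.\<close>

lemma basis_modulo_exists:
  assumes "subspace V" "subspace W" "fin_dim V"
  shows "\<exists>B. basis_modulo scale W V B"
proof -
  obtain C where C: "C \<subseteq> V \<inter> W" "independent C" "V \<inter> W \<subseteq> span C"
    using basis_exists by metis
  have "C \<subseteq> V" using C by simp
  then obtain D where D: "C \<subseteq> D" "D \<subseteq> V" "independent D" "V \<subseteq> span D"
    using C(2) by (rule maximal_independent_subset_extend)
  have finD: "finite D" using D assms fin_dim_independent_finite by blast
  have spanC: "span C = V \<inter> W" using C assms by (simp add: span_subspace subspace_inter)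
  have "basis_modulo scale W V (D - C)"
    unfolding basis_modulo_def
  proof (intro conjI allI impI ballI)
    show "D - C \<subseteq> V" using D by auto
  next
    fix S c b assume S: "finite S \<and> S \<subseteq> D - C \<and> (\<Sum>b\<in>S. c b *s b) \<in> W" and b: "b \<in> S"
    have "(\<Sum>b\<in>S. c b *s b) \<in> V"
      using S D assms by (intro subspace_sum subspace_scale) auto
    then have "(\<Sum>b\<in>S. c b *s b) \<in> span C" using S spanC by auto
    moreover have finC: "finite C" by (rule finite_subset[OF D(1) finD])
    ultimately obtain d where d: "(\<Sum>b\<in>S. c b *s b) = (\<Sum>b\<in>C. d b *s b)"
      by (auto simp: span_finite)
    define e where "e x = (if x \<in> S then c x else - d x)" for x
    have SC: "S \<inter> C = {}" using S by auto
    have "(\<Sum>x\<in>S \<union> C. e x *s x) = (\<Sum>x\<in>S. e x *s x) + (\<Sum>x\<in>C. e x *s x)"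
      using S finC SC by (simp add: sum.union_disjoint)
    also have "(\<Sum>x\<in>S. e x *s x) = (\<Sum>x\<in>S. c x *s x)" by (simp add: e_def)
    also have "(\<Sum>x\<in>C. e x *s x) = (\<Sum>x\<in>C. - (d x *s x))"
      using SC by (intro sum.cong) (auto simp: e_def)
    finally have "(\<Sum>x\<in>S \<union> C. e x *s x) = 0" using d by (simp add: sum_negf)
    moreover have "S \<union> C \<subseteq> D" "finite (S \<union> C)" using S D finC by auto
    ultimately have "e b = 0" using independentD[OF D(3)] b by blast
    then show "c b = 0" using b by (simp add: e_def)
  next
    fix v assume "v \<in> V"
    then have "v \<in> span (C \<union> (D - C))" using D by (simp add: Un_absorb1 subset_iff)
    then obtain x y where "v = x + y" "x \<in> span C" "y \<in> span (D - C)"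
      unfolding span_Un by blast
    then show "\<exists>u\<in>span (D - C). v - u \<in> W" using spanC by (intro bexI[of _ y]) auto
  qed
  then show ?thesis by blast
qed

lemma dim_modulo_eq:
  assumes "subspace V" "subspace W" "fin_dim V"
  shows "dim_modulo scale W V = dim V - dim (V \<inter> W)"
proof -
  have "basis_modulo scale W V (SOME B. basis_modulo scale W V B)"
    by (rule someI_ex[OF basis_modulo_exists[OF assms]])
  from basis_modulo_card[OF assms this] show ?thesis
    by (simp add: dim_modulo_def)
qed

end

section \<open>Graded components\<close>

interpretation ideal: module "(*) :: 'r::comm_ring_1 \<Rightarrow> 'r \<Rightarrow> 'r"
  by (rule module_times)

text \<open>As a simp rule this would reassociate products to the left.\<close>

declare ideal.scale_scale [simp del]

context standard_graded_algebra
begin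

definition component :: "'r \<Rightarrow> nat \<Rightarrow> 'r"
  where "component r = (THE f. (\<forall>t. f t \<in> R t) \<and> finite {t. f t \<noteq> 0} \<and> r = (\<Sum>t | f t \<noteq> 0. f t))"

lemma component:
  shows component_in: "component r t \<in> R t"
    and finite_component: "finite {t. component r t \<noteq> 0}"
    and sum_component: "r = (\<Sum>t | component r t \<noteq> 0. component r t)"
  using theI'[OF direct_sum[of r]] unfolding component_def[symmetric] by simp_all

lemma zero_in_component: "0 \<in> R t"
  using subspace_component by (rule subspace_0)

lemma ex1_implies_eq: "P f \<Longrightarrow> P g \<Longrightarrow> \<exists>!f. P f \<Longrightarrow> g = f"
  by blast

text \<open>By uniqueness in \<open>direct_sum\<close>, any finite decomposition into pieces of the
  right degrees is the canonical one; \<open>A\<close> may contain degrees where \<open>f\<close>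
  vanishes.\<close>

lemma component_eqI:
  assumes "finite A" "\<And>t. t \<in> A \<Longrightarrow> f t \<in> R t" "r = (\<Sum>t\<in>A. f t)"
  shows "component r = (\<lambda>t. if t \<in> A then f t else 0)"
proof -
  let ?g = "\<lambda>t. if t \<in> A then f t else 0"
  have "finite {t. ?g t \<noteq> 0}"
    using assms(1) by (rule rev_finite_subset) auto
  moreover have "r = (\<Sum>t | ?g t \<noteq> 0. ?g t)"
    unfolding assms(3) using assms(1) by (intro sum.mono_neutral_cong_right) auto
  moreover have "\<forall>t. ?g t \<in> R t" using assms(2) zero_in_component by auto
  ultimately have "(\<forall>t. ?g t \<in> R t) \<and> finite {t. ?g t \<noteq> 0} \<and> r = (\<Sum>t | ?g t \<noteq> 0. ?g t)"
    by simp
  moreover have "(\<forall>t. component r t \<in> R t) \<and> finite {t. component r t \<noteq> 0} \<and>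
      r = (\<Sum>t | component r t \<noteq> 0. component r t)"
    using component_in finite_component sum_component by simp
  ultimately show ?thesis
    using direct_sum[of r] by (rule ex1_implies_eq)
qed

lemma sum_component_superset:
  assumes "finite A" "\<And>t. component r t \<noteq> 0 \<Longrightarrow> t \<in> A"
  shows "r = (\<Sum>t\<in>A. component r t)"
proof -
  have "r = (\<Sum>t | component r t \<noteq> 0. component r t)" by (rule sum_component)
  also have "\<dots> = (\<Sum>t\<in>A. component r t)"
    using assms by (intro sum.mono_neutral_left) auto
  finally show ?thesis .
qed

lemma component_homogeneous: "x \<in> R s \<Longrightarrow> component x t = (if t = s then x else 0)"
  using component_eqI[of "{s}" "\<lambda>_. x" x] by simp

lemma component_of_zero [simp]: "component 0 t = 0"
  using component_homogeneous[OF zero_in_component, of t 0] by simp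

lemma component_eq_0_imp: "(\<And>t. component r t = 0) \<Longrightarrow> r = 0"
  using sum_component[of r] by simp

lemma component_add: "component (x + y) t = component x t + component y t"
proof -
  let ?A = "{t. component x t \<noteq> 0} \<union> {t. component y t \<noteq> 0}"
  have fin: "finite ?A" using finite_component by auto
  have "x = (\<Sum>t\<in>?A. component x t)" "y = (\<Sum>t\<in>?A. component y t)"
    using fin by (rule sum_component_superset; simp)+
  then have "x + y = (\<Sum>t\<in>?A. component x t + component y t)"
    by (simp only: sum.distrib)
  with fin have "component (x + y) = (\<lambda>t. if t \<in> ?A then component x t + component y t else 0)"
    by (intro component_eqI subspace_add subspace_component component_in)
  then show ?thesis by auto
qed

lemma component_sum: "component (sum f A) t = (\<Sum>a\<in>A. component (f a) t)"
  by (induction A rule: infinite_finite_induct) (auto simp: component_add)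

lemma component_mult:
  assumes "x \<in> R s"
  shows "component (x * y) t = (if s \<le> t then x * component y (t - s) else 0)"
proof -
  let ?A = "{t. component y t \<noteq> 0}"
  have fin: "finite ?A" by (rule finite_component)
  have "x * y = (\<Sum>i\<in>?A. x * component y i)"
    by (subst sum_component[of y]) (simp add: sum_distrib_left)
  also have "\<dots> = (\<Sum>t\<in>(+) s ` ?A. x * component y (t - s))"
    by (subst sum.reindex) auto
  finally have "component (x * y) = (\<lambda>t. if t \<in> (+) s ` ?A then x * component y (t - s) else 0)"
    using fin assms component_in mult_component by (intro component_eqI) auto
  moreover have "t \<in> (+) s ` ?A \<longleftrightarrow> s \<le> t \<and> component y (t - s) \<noteq> 0"
    by (auto simp: image_iff intro!: exI[of _ "t - s"])
  ultimately show ?thesis by auto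
qed

lemma mult_scale: "x * scale c y = scale c (x * y)"
  using scale_mult[of c y x] by (simp add: mult.commute)

lemma linear_mult: "Vector_Spaces.linear scale scale ((*) x)"
  by unfold_locales (simp_all add: distrib_left mult_scale scale_right_distrib scale_left_distrib)

lemma component_scale: "component (scale c x) t = scale c (component x t)"
proof -
  \<comment> \<open>Scaling is multiplication by an element of degree 0, so
    \<open>component_mult\<close> applies.\<close>
  have "scale c 1 \<in> R 0" unfolding component_0 by blast
  from component_mult[OF this, of x t] show ?thesis
    using scale_mult[of c 1, symmetric] by simp
qed

lemma one_in_R0: "1 \<in> R 0"
  unfolding component_0 using scale_one[of 1] by (metis rangeI)

text \<open>The hull in \<open>generated_in_degree_1\<close> does not mention degrees. This extracts
  the graded form: \<open>R t\<close> is spanned by the products of \<open>t\<close>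
  generators.\<close>

lemma component_generation:
  obtains S where "finite S" "S \<subseteq> R 1"
    "\<And>t. R (Suc t) = span {s * x |s x. s \<in> S \<and> x \<in> R t}" "R 0 = span {1}"
proof -
  obtain S where S: "finite S" "S \<subseteq> R 1"
    "(\<lambda>A. subspace A \<and> 1 \<in> A \<and> (\<forall>x\<in>A. \<forall>y\<in>A. x * y \<in> A)) hull S = UNIV"
    using generated_in_degree_1 by blast
  \<comment> \<open>\<open>G t\<close> is the span of the products of \<open>t\<close> generators,
    the candidate for \<open>R t\<close>.\<close>
  define G where "G = rec_nat (span {1}) (\<lambda>_ G. span {s * x |s x. s \<in> S \<and> x \<in> G})"
  have G0: "G 0 = span {1}" and GSuc: "G (Suc t) = span {s * x |s x. s \<in> S \<and> x \<in> G t}" for t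
    by (simp_all add: G_def)
  have subG: "subspace (G t)" for t by (cases t) (simp_all add: G0 GSuc)
  have GR: "G t \<subseteq> R t" for t
  proof (induction t)
    case 0
    then show ?case using one_in_R0 unfolding G0
      by (intro span_minimal subspace_component) auto
  next
    case (Suc t)
    have "s * x \<in> R (Suc t)" if "s \<in> S" "x \<in> G t" for s x
      using mult_component[of s 1 x t] that Suc S by auto
    then show ?case unfolding GSuc by (intro span_minimal subspace_component) auto
  qed
  \<comment> \<open>\<open>A\<close> is the sum of the \<open>G t\<close>. Once it is seen to be a
    subalgebra containing \<open>S\<close>, minimality of the hull makes it the whole ring, which
    forces \<open>R t = G t\<close>.\<close>
  define A where "A = {r. \<forall>t. component r t \<in> G t}"
  have subA: "subspace A"
    using subG unfolding A_def subspace_def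
    by (auto simp: component_add component_scale)
  have A1: "s * y \<in> A" if "s \<in> S" "y \<in> A" for s y
    unfolding A_def
  proof (intro CollectI allI)
    fix t
    have "s \<in> R 1" using that S by auto
    then have c: "component (s * y) t = (if 1 \<le> t then s * component y (t - 1) else 0)"
      by (rule component_mult)
    show "component (s * y) t \<in> G t"
    proof (cases t)
      case 0
      then show ?thesis using c subspace_0[OF subG] by simp
    next
      case (Suc k)
      then have "component (s * y) t = s * component y k" using c by simp
      moreover have "component y k \<in> G k" using that by (simp add: A_def)
      ultimately show ?thesis using that Suc by (auto simp: GSuc intro!: span_base)
    qed
  qed
  have A2: "x * y \<in> A" if "x \<in> G i" "y \<in> A" for x y i
    using that
  proof (induction i arbitrary: x y)
    case 0
    then obtain c where "x = scale c 1" by (auto simp: G0 span_singleton)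
    then have "x * y = scale c y" by (simp flip: scale_mult)
    then show ?case using 0 subA by (simp add: subspace_scale)
  next
    case (Suc i)
    interpret m: Vector_Spaces.linear scale scale "(*) y" by (rule linear_mult)
    have "s * x * y \<in> A" if "s \<in> S" "x \<in> G i" for s x
      unfolding mult.assoc by (rule A1) (use that Suc in auto)
    then have "{s * x |s x. s \<in> S \<and> x \<in> G i} \<subseteq> {x. y * x \<in> A}"
      by (auto simp: mult.commute[of y])
    then have "G (Suc i) \<subseteq> {x. y * x \<in> A}"
      unfolding GSuc using m.subspace_linear_preimage[OF subA] by (rule span_minimal)
    then show ?case using Suc by (auto simp: mult.commute[of y])
  qed
  have "x * y \<in> A" if "x \<in> A" "y \<in> A" for x y
  proof -
    have "x * y = (\<Sum>t | component x t \<noteq> 0. component x t * y)"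
      by (subst sum_component[of x]) (simp add: sum_distrib_right)
    also have "\<dots> \<in> A"
    proof (rule subspace_sum[OF subA])
      show "component x t * y \<in> A" for t
        using that(1) by (intro A2[of _ t, OF _ that(2)]) (simp add: A_def)
    qed
    finally show ?thesis .
  qed
  moreover have "1 \<in> A"
    unfolding A_def using one_in_R0 subG
    by (auto simp: component_homogeneous G0 span_base subspace_0)
  moreover have "S \<subseteq> A"
  proof
    fix s assume "s \<in> S"
    then have "s * 1 \<in> A" using \<open>1 \<in> A\<close> by (rule A1)
    then show "s \<in> A" by simp
  qed
  ultimately have UA: "UNIV \<subseteq> A"
    unfolding S(3)[symmetric] using subA by (intro hull_minimal) auto
  have RG: "R t = G t" for t
  proof
    show "R t \<subseteq> G t"
    proof
      fix r assume "r \<in> R t"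
      then have "component r t = r" by (simp add: component_homogeneous)
      moreover have "component r t \<in> G t" using UA by (auto simp: A_def)
      ultimately show "r \<in> G t" by simp
    qed
  qed (rule GR)
  show ?thesis
    by (rule that[of S]) (use S G0 GSuc RG in auto)
qed

lemma fin_dim_component: "fin_dim (R t)"
proof -
  obtain S where S: "finite S" "S \<subseteq> R 1"
      "\<And>t. R (Suc t) = span {s * x |s x. s \<in> S \<and> x \<in> R t}" "R 0 = span {1}"
    by (rule component_generation) (rule that)
  show ?thesis
  proof (induction t)
    case 0
    then show ?case unfolding S(4) by (rule fin_dim_span) simp
  next
    case (Suc t)
    then obtain B where B: "finite B" "R t \<subseteq> span B" unfolding fin_dim_def by blast
    let ?C = "(\<lambda>(s, b). s * b) ` (S \<times> B)"
    have "s * x \<in> span ?C" if "s \<in> S" "x \<in> R t" for s x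
    proof -
      interpret m: Vector_Spaces.linear scale scale "(*) s" by (rule linear_mult)
      have "s * x \<in> (*) s ` span B" using that B by auto
      then have "s * x \<in> span ((*) s ` B)" by (simp add: m.span_image)
      moreover have "(*) s ` B \<subseteq> ?C" using that by auto
      ultimately show ?thesis using span_mono by blast
    qed
    then have "R (Suc t) \<subseteq> span ?C"
      unfolding S(3) by (intro span_minimal) auto
    moreover have "finite ?C" using S B by auto
    ultimately show ?case unfolding fin_dim_def by blast
  qed
qed

text \<open>A form free of the chosen generators, used for inductions on the degree.\<close>

lemma component_Suc: "R (Suc t) = span {s * x |s x. s \<in> R 1 \<and> x \<in> R t}"
proof -
  obtain S where S: "finite S" "S \<subseteq> R 1"
      "\<And>t. R (Suc t) = span {s * x |s x. s \<in> S \<and> x \<in> R t}" "R 0 = span {1}"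
    by (rule component_generation) (rule that)
  show ?thesis
  proof
    show "R (Suc t) \<subseteq> span {s * x |s x. s \<in> R 1 \<and> x \<in> R t}"
      unfolding S(3) by (rule span_mono) (use S(2) in blast)
    show "span {s * x |s x. s \<in> R 1 \<and> x \<in> R t} \<subseteq> R (Suc t)"
      using mult_component[of _ 1 _ t] by (intro span_minimal subspace_component) auto
  qed
qed

section \<open>Homogeneous ideals\<close>

lemma ideal_imp_subspace: "is_ideal I \<Longrightarrow> subspace I"
  unfolding subspace_def ideal.subspace_def
  by (metis mult_1 scale_mult)

definition homogeneous_ideal :: "'r set \<Rightarrow> bool"
  where "homogeneous_ideal I \<longleftrightarrow> is_ideal I \<and> (\<forall>r\<in>I. \<forall>t. component r t \<in> I)"

lemma homogeneous_ideal_zero: "homogeneous_ideal {0}"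
  by (simp add: homogeneous_ideal_def)

text \<open>The elements all of whose components lie in the generated ideal form an ideal containing
  \<open>F\<close>, hence containing the generated ideal.\<close>

lemma homogeneous_ideal_gen:
  assumes "F \<subseteq> R e"
  shows "homogeneous_ideal (ideal_gen F)"
proof -
  let ?I = "ideal_gen F"
  let ?J = "{r. \<forall>t. component r t \<in> ?I}"
  have "is_ideal ?J"
  proof (rule ideal.subspaceI)
    show "0 \<in> ?J" by (simp add: ideal.span_zero)
    show "x + y \<in> ?J" if "x \<in> ?J" "y \<in> ?J" for x y
      using that by (simp add: component_add ideal.span_add)
    show "c * x \<in> ?J" if x: "x \<in> ?J" for c x
    proof -
      have "c * x = (\<Sum>i | component c i \<noteq> 0. component c i * x)"
        by (subst sum_component[of c]) (simp add: sum_distrib_right)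
      then have "component (c * x) t \<in> ?I" for t
        using x component_mult[OF component_in[of c]]
        by (auto simp: component_sum intro!: ideal.span_sum ideal.span_zero ideal.span_scale)
      then show ?thesis by simp
    qed
  qed
  moreover have "F \<subseteq> ?J"
    using assms by (auto simp: component_homogeneous subset_iff ideal.span_zero ideal.span_base)
  ultimately have "?I \<subseteq> ?J" by (intro ideal.span_minimal)
  then show ?thesis unfolding homogeneous_ideal_def by auto
qed

section \<open>The ideals \<open>I + (f)\<close> and \<open>(I : f)\<close> for a homogeneous
  element \<open>f\<close>\<close>

definition add_principal :: "'r set \<Rightarrow> 'r \<Rightarrow> 'r set"
  where "add_principal I f = {x + y |x y. x \<in> I \<and> y \<in> range ((*) f)}"

definition colon :: "'r set \<Rightarrow> 'r \<Rightarrow> 'r set"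
  where "colon I f = {r. f * r \<in> I}"

lemma add_principal_superset: "is_ideal I \<Longrightarrow> I \<subseteq> add_principal I f"
  unfolding add_principal_def by (force intro: image_eqI[of _ _ 0])

lemma in_add_principal: "is_ideal I \<Longrightarrow> f \<in> add_principal I f"
  unfolding add_principal_def using ideal.subspace_0 by (force intro: image_eqI[of _ _ 1])

lemma colon_superset: "is_ideal I \<Longrightarrow> I \<subseteq> colon I f"
  unfolding colon_def using ideal.subspace_scale by blast

lemma homogeneous_add_principal:
  assumes "homogeneous_ideal I" "f \<in> R e"
  shows "homogeneous_ideal (add_principal I f)"
proof -
  have I: "is_ideal I" using assms by (simp add: homogeneous_ideal_def)
  have *: "is_ideal (range ((*) f))"
  proof (rule ideal.subspaceI)
    show "0 \<in> range ((*) f)" by (rule range_eqI[of _ _ 0]) simp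
    show "x + y \<in> range ((*) f)" if "x \<in> range ((*) f)" "y \<in> range ((*) f)" for x y
      using that by (auto simp flip: distrib_left)
    show "c * x \<in> range ((*) f)" if "x \<in> range ((*) f)" for c x
    proof -
      from that obtain y where "x = f * y" by blast
      then have "c * x = f * (c * y)" by (simp add: mult.left_commute)
      then show ?thesis by blast
    qed
  qed
  have "add_principal I f = ideal_gen (I \<union> range ((*) f))"
    unfolding add_principal_def ideal.span_Un
    by (simp only: ideal.span_eq_iff[THEN iffD2, OF I] ideal.span_eq_iff[THEN iffD2, OF *])
  then have "is_ideal (add_principal I f)" by simp
  moreover have "component (x + f * y) t \<in> add_principal I f" if "x \<in> I" for x y t
  proof -
    have "component (x + f * y) t = component x t + f * (if e \<le> t then component y (t - e) else 0)"
      using assms by (simp add: component_add component_mult)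
    moreover have "component x t \<in> I" using that assms by (simp add: homogeneous_ideal_def)
    ultimately show ?thesis unfolding add_principal_def by blast
  qed
  ultimately show ?thesis
    unfolding homogeneous_ideal_def add_principal_def by auto
qed

lemma homogeneous_colon:
  assumes "homogeneous_ideal I" "f \<in> R e"
  shows "homogeneous_ideal (colon I f)"
proof -
  have I: "is_ideal I" using assms by (simp add: homogeneous_ideal_def)
  then have "is_ideal (colon I f)"
    unfolding colon_def ideal.subspace_def
    by (simp add: distrib_left mult.left_commute[of f])
  moreover have "f * component r t \<in> I" if "f * r \<in> I" for r t
  proof -
    have "component (f * r) (t + e) \<in> I"
      using that assms by (simp add: homogeneous_ideal_def)
    then show ?thesis using assms by (simp add: component_mult)
  qed
  ultimately show ?thesis by (simp add: homogeneous_ideal_def colon_def)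
qed

text \<open>The additive form avoids truncated subtraction in later counts.\<close>

lemma hilbert_quotient_eq:
  assumes "is_ideal I"
  shows "hilbert_quotient I t + dim (R t \<inter> I) = dim (R t)"
  unfolding hilbert_quotient_def
    dim_modulo_eq[OF subspace_component ideal_imp_subspace[OF assms] fin_dim_component]
  by (simp add: fin_dim_dim_mono fin_dim_component)

text \<open>Dimension count for the exact sequence that embeds \<open>R/(I : f)\<close>, shifted by
  \<open>e\<close>, into \<open>R/I\<close> through multiplication by \<open>f\<close>, with
  cokernel \<open>R/(I + f)\<close>.\<close>

lemma hilbert_quotient_add_colon:
  assumes "homogeneous_ideal I" "f \<in> R e"
  shows "hilbert_quotient I t =
    hilbert_quotient (add_principal I f) t + (if e \<le> t then hilbert_quotient (colon I f) (t - e) else 0)"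
proof -
  have id: "is_ideal I" "is_ideal (add_principal I f)" "is_ideal (colon I f)"
    using assms homogeneous_add_principal homogeneous_colon by (auto simp: homogeneous_ideal_def)
  note h = id[THEN hilbert_quotient_eq]
  \<comment> \<open>An element of \<open>I + (f)\<close> that is homogeneous of degree
    \<open>t\<close> can be written with both summands of degree \<open>t\<close>: take the degree
    \<open>t\<close> components.\<close>
  have *: "\<exists>x'\<in>R t \<inter> I. x + f * y = x' + f * (if e \<le> t then component y (t - e) else 0)"
    if "x \<in> I" "x + f * y \<in> R t" for x y
  proof -
    have "x + f * y = component (x + f * y) t"
      using that by (simp add: component_homogeneous)
    also have "\<dots> = component x t + f * (if e \<le> t then component y (t - e) else 0)"
      using assms by (simp add: component_add component_mult)
    finally show ?thesis
      using that assms component_in by (auto simp: homogeneous_ideal_def)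
  qed
  show ?thesis
  proof (cases "e \<le> t")
    case True
    have "R t \<inter> add_principal I f = {x + y |x y. x \<in> R t \<inter> I \<and> y \<in> (*) f ` R (t - e)}" (is "?L = ?R")
    proof
      show "?L \<subseteq> ?R"
        using * True component_in[of _ "t - e"] unfolding add_principal_def by fastforce
      show "?R \<subseteq> ?L"
        using True mult_component[OF assms(2), of _ "t - e"] subspace_add[OF subspace_component]
        unfolding add_principal_def by auto
    qed
    moreover have "{u \<in> R (t - e). f * u \<in> R t \<inter> I} = R (t - e) \<inter> colon I f"
      using True mult_component[OF assms(2), of _ "t - e"] by (auto simp: colon_def)
    moreover have "subspace (R t \<inter> I)"
      using id by (intro subspace_inter subspace_component ideal_imp_subspace)
    moreover have "fin_dim (R t \<inter> I)"
      using fin_dim_component[of t] by (rule fin_dim_subset) simp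
    ultimately have "dim (R t \<inter> add_principal I f) + dim (R (t - e) \<inter> colon I f)
        = dim (R t \<inter> I) + dim (R (t - e))"
      using dim_plus_image[OF linear_mult subspace_component _ fin_dim_component, of "R t \<inter> I" f "t - e"]
      by simp
    then show ?thesis using h(1)[of t] h(2)[of t] h(3)[of "t - e"] True by simp
  next
    \<comment> \<open>Below degree \<open>e\<close> the multiples of \<open>f\<close> contribute
      nothing.\<close>
    case False
    then have "R t \<inter> add_principal I f = R t \<inter> I"
      using * add_principal_superset[OF id(1), of f] unfolding add_principal_def by fastforce
    then show ?thesis using h(1)[of t] h(2)[of t] False by simp
  qed
qed

end

section \<open>Growth of Hilbert functions\<close>

text \<open>The Stolz-Cesaro theorem: a weighted average of the ratios \<open>u i / w i\<close> has
  their limit, since the weight of any initial segment becomes negligible.\<close>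

lemma ratio_sums_tendsto:
  fixes u w :: "nat \<Rightarrow> real"
  assumes w: "\<And>i. w i > 0" "filterlim (\<lambda>t. \<Sum>i<t. w i) at_top sequentially"
    and uw: "(\<lambda>i. u i / w i) \<longlonglongrightarrow> c"
  shows "(\<lambda>t. (\<Sum>i<t. u i) / (\<Sum>i<t. w i)) \<longlonglongrightarrow> c"
proof (rule LIMSEQ_I)
  fix r :: real assume r: "r > 0"
  then obtain N where N: "\<And>i. i \<ge> N \<Longrightarrow> \<bar>u i / w i - c\<bar> < r / 2"
    using LIMSEQ_D[OF uw, of "r / 2"] by auto
  have term_bound: "\<bar>u i - c * w i\<bar> \<le> r / 2 * w i" if "i \<ge> N" for i
  proof -
    have "u i - c * w i = (u i / w i - c) * w i" using w(1)[of i] by (simp add: field_simps)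
    then have "\<bar>u i - c * w i\<bar> = \<bar>u i / w i - c\<bar> * w i" using w(1)[of i] by (simp add: abs_mult)
    then show ?thesis using N[OF that] w(1)[of i] by (simp add: mult_right_mono)
  qed
  \<comment> \<open>\<open>D\<close> is the error of the initial segment; once the total weight
    exceeds \<open>4 * D / r\<close>, it costs less than half of the allowed error.\<close>
  define D where "D = \<bar>\<Sum>i<N. u i - c * w i\<bar>"
  have "\<forall>\<^sub>F t in sequentially. (\<Sum>i<t. w i) > max 1 (4 * D / r)"
    using w(2) unfolding filterlim_at_top_dense by blast
  then obtain M where M: "\<And>t. t \<ge> M \<Longrightarrow> (\<Sum>i<t. w i) > max 1 (4 * D / r)"
    by (auto simp: eventually_sequentially)
  show "\<exists>no. \<forall>t\<ge>no. norm ((\<Sum>i<t. u i) / (\<Sum>i<t. w i) - c) < r"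
  proof (intro exI allI impI)
    fix t assume t: "t \<ge> max M N"
    let ?W = "\<Sum>i<t. w i"
    have W: "?W > 1" "?W > 4 * D / r" using M[of t] t by auto
    have split: "{..<t} = {..<N} \<union> {N..<t}" using t by auto
    have "\<bar>\<Sum>i<t. u i - c * w i\<bar> \<le> D + \<bar>\<Sum>i\<in>{N..<t}. u i - c * w i\<bar>"
      unfolding split D_def by (subst sum.union_disjoint) auto
    also have "\<bar>\<Sum>i\<in>{N..<t}. u i - c * w i\<bar> \<le> (\<Sum>i\<in>{N..<t}. r / 2 * w i)"
      by (rule order.trans[OF sum_abs], rule sum_mono, rule term_bound) simp
    also have "\<dots> \<le> (\<Sum>i<t. r / 2 * w i)"
      using w(1) r by (intro sum_mono2) (auto intro: less_imp_le)
    also have "\<dots> = r / 2 * ?W" by (simp add: sum_distrib_left)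
    finally have "\<bar>\<Sum>i<t. u i - c * w i\<bar> \<le> D + r / 2 * ?W" by simp
    also have "\<dots> < r * ?W"
    proof -
      have "4 * D < r * ?W" "0 \<le> D" using W r by (simp_all add: field_simps D_def)
      then show ?thesis by linarith
    qed
    finally have "\<bar>(\<Sum>i<t. u i) - c * ?W\<bar> < r * ?W"
      by (simp add: sum_subtractf sum_distrib_left)
    moreover have "(\<Sum>i<t. u i) / ?W - c = ((\<Sum>i<t. u i) - c * ?W) / ?W"
      using W by (simp add: field_simps)
    ultimately show "norm ((\<Sum>i<t. u i) / ?W - c) < r"
      using W by (simp add: field_simps)
  qed
qed

text \<open>The difference of powers factors into \<open>Suc n\<close> summands, each of which tends
  to 1 after division.\<close>

lemma power_increment_tendsto:
  "(\<lambda>t. (real (Suc t) ^ Suc n - real t ^ Suc n) / real (Suc t) ^ n) \<longlonglongrightarrow> real (Suc n)"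
proof -
  have "(real (Suc t) ^ Suc n - real t ^ Suc n) / real (Suc t) ^ n
      = (\<Sum>p<Suc n. (real t / real (Suc t)) ^ (n - p))" for t
  proof -
    have "real (Suc t) ^ p * real t ^ (n - p) / real (Suc t) ^ n = (real t / real (Suc t)) ^ (n - p)"
      if "p < Suc n" for p
    proof -
      have "real (Suc t) ^ n = real (Suc t) ^ p * real (Suc t) ^ (n - p)"
        using that by (simp flip: power_add)
      then show ?thesis by (simp add: power_divide)
    qed
    moreover have "real (Suc t) ^ Suc n - real t ^ Suc n
        = (\<Sum>p<Suc n. real (Suc t) ^ p * real t ^ (n - p))"
      by (subst diff_power_eq_sum) simp
    ultimately show ?thesis
      by (simp only: sum_divide_distrib) (intro sum.cong; simp)
  qed
  moreover have "(\<lambda>t. \<Sum>p<Suc n. (real t / real (Suc t)) ^ (n - p)) \<longlonglongrightarrow> (\<Sum>p<Suc n. 1 ^ (n - p))"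
    by (intro tendsto_intros LIMSEQ_n_over_Suc_n)
  ultimately show ?thesis by simp
qed

text \<open>The exponent \<open>n\<close> is free, so growth can be studied before it is compared
  with the Krull dimension. The value \<open>c = 0\<close> is allowed and means growth of lower
  order.\<close>

definition has_multiplicity :: "(nat \<Rightarrow> nat) \<Rightarrow> nat \<Rightarrow> real \<Rightarrow> bool"
  where "has_multiplicity h n c \<longleftrightarrow> (\<lambda>t. fact n * real (\<Sum>i\<le>t. h i) / real t ^ n) \<longlonglongrightarrow> c"

text \<open>Stolz-Cesaro with the increments of \<open>i ^ Suc n\<close> as weights. They grow like
  \<open>Suc n\<close> times \<open>i ^ n\<close>, and this factor turns \<open>fact n\<close> into
  \<open>fact (Suc n)\<close>.\<close>

lemma has_multiplicity_partial_sums: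
  assumes "has_multiplicity h n c"
  shows "has_multiplicity (\<lambda>t. \<Sum>i\<le>t. h i) (Suc n) c"
proof -
  let ?S = "\<lambda>t. \<Sum>i\<le>t. h i"
  let ?w = "\<lambda>i. real (Suc i) ^ Suc n - real i ^ Suc n"
  have sumw: "(\<Sum>i<t. ?w i) = real t ^ Suc n" for t
    using sum_lessThan_telescope[of "\<lambda>i. real i ^ Suc n" t] by simp
  have "(\<lambda>t. fact n * real (?S (Suc t)) / real (Suc t) ^ n) \<longlonglongrightarrow> c"
    using assms unfolding has_multiplicity_def by (rule LIMSEQ_Suc)
  then have "(\<lambda>t. (fact n * real (?S (Suc t)) / real (Suc t) ^ n) /
      (?w t / real (Suc t) ^ n)) \<longlonglongrightarrow> c / real (Suc n)"
    by (intro tendsto_divide power_increment_tendsto) auto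
  then have "(\<lambda>t. fact n * real (?S (Suc t)) / ?w t) \<longlonglongrightarrow> c / real (Suc n)"
    by simp
  moreover have "?w i > 0" for i
    using power_strict_mono[of "real i" "real (Suc i)" "Suc n"] by simp
  moreover have "filterlim (\<lambda>t. \<Sum>i<t. ?w i) at_top sequentially"
    unfolding sumw by (intro filterlim_pow_at_top filterlim_real_sequentially) simp
  ultimately have "(\<lambda>t. (\<Sum>i<t. fact n * real (?S (Suc i))) / (\<Sum>i<t. ?w i)) \<longlonglongrightarrow> c / real (Suc n)"
    by (intro ratio_sums_tendsto)
  then have "(\<lambda>t. (\<Sum>i<t. fact n * real (?S (Suc i))) / real t ^ Suc n) \<longlonglongrightarrow> c / real (Suc n)"
    unfolding sumw .
  moreover have "(\<lambda>t. 1 / real t ^ Suc n) \<longlonglongrightarrow> 0"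
    by (intro tendsto_divide_0[OF tendsto_const] filterlim_at_top_imp_at_infinity
        filterlim_pow_at_top filterlim_real_sequentially) simp
  \<comment> \<open>The shifted sum omits the first partial sum \<open>h 0\<close>; its contribution
    is added as a term tending to 0.\<close>
  ultimately have "(\<lambda>t. real (Suc n) * ((\<Sum>i<t. fact n * real (?S (Suc i))) / real t ^ Suc n)
      + fact (Suc n) * real (h 0) * (1 / real t ^ Suc n))
      \<longlonglongrightarrow> real (Suc n) * (c / real (Suc n)) + fact (Suc n) * real (h 0) * 0"
    by (intro tendsto_add tendsto_mult_left)
  moreover have "real (Suc n) * ((\<Sum>i<t. fact n * real (?S (Suc i))) / real t ^ Suc n)
      + fact (Suc n) * real (h 0) * (1 / real t ^ Suc n)
      = fact (Suc n) * real (\<Sum>i\<le>t. ?S i) / real t ^ Suc n" for t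
  proof -
    have "(\<Sum>i\<le>t. ?S i) = h 0 + (\<Sum>i<t. ?S (Suc i))"
      using sum.atMost_shift[of ?S t] by simp
    then show ?thesis
      by (simp add: add_divide_distrib[symmetric] sum_distrib_left[symmetric] algebra_simps del: sum.atMost_Suc)
  qed
  ultimately show ?thesis unfolding has_multiplicity_def by simp
qed

lemma has_multiplicity_Suc:
  assumes "has_multiplicity h n c"
  shows "has_multiplicity h (Suc n) 0"
proof -
  have "(\<lambda>t. real (Suc n) * (fact n * real (\<Sum>i\<le>t. h i) / real t ^ n) * (1 / real t)) \<longlonglongrightarrow> real (Suc n) * c * 0"
    using assms unfolding has_multiplicity_def by (intro tendsto_intros lim_1_over_n)
  then show ?thesis unfolding has_multiplicity_def
    by (simp add: field_simps)
qed

lemma has_multiplicity_mono_degree: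
  assumes "has_multiplicity h m (real c)" "m \<le> n"
  shows "\<exists>c. has_multiplicity h n (real c)"
  using assms(2,1)
proof (induction n rule: dec_induct)
  case (step k)
  then show ?case using has_multiplicity_Suc[of h k] of_nat_0 by metis
qed blast

lemma has_multiplicity_zero: "has_multiplicity (\<lambda>_. 0) n 0"
  by (simp add: has_multiplicity_def)

text \<open>Multiplicity is additive, and a shift by \<open>e\<close> only replaces
  \<open>t ^ n\<close> by \<open>(t + e) ^ n\<close>, a factor tending to 1.\<close>

lemma has_multiplicity_add_shift:
  assumes "has_multiplicity h1 n c1" "has_multiplicity h2 n c2"
    and h: "\<And>t. h t = h1 t + (if e \<le> t then h2 (t - e) else 0)"
  shows "has_multiplicity h n (c1 + c2)"
proof -
  let ?f = "\<lambda>h t. fact n * real (\<Sum>i\<le>t. h i) / real t ^ n"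
  have "(\<lambda>t. ?f h2 t * (real t / (real t + real e)) ^ n) \<longlonglongrightarrow> c2 * 1 ^ n"
  proof (intro tendsto_intros)
    show "?f h2 \<longlonglongrightarrow> c2" using assms(2) by (simp add: has_multiplicity_def)
    have "(\<lambda>t. 1 - real e / real (t + e)) \<longlonglongrightarrow> 1 - 0"
      by (intro tendsto_intros LIMSEQ_ignore_initial_segment[of "\<lambda>t. real e / real t"] lim_const_over_n)
    moreover have "\<forall>\<^sub>F t in sequentially. 1 - real e / real (t + e) = real t / (real t + real e)"
      using eventually_gt_at_top[of 0] by eventually_elim (simp add: field_simps)
    ultimately show "(\<lambda>t. real t / (real t + real e)) \<longlonglongrightarrow> 1"
      by (simp add: tendsto_cong)
  qed
  moreover have "\<forall>\<^sub>F t in sequentially. ?f h2 t * (real t / (real t + real e)) ^ n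
      = fact n * real (\<Sum>i\<le>t. h2 i) / real (t + e) ^ n"
    using eventually_gt_at_top[of 0] by eventually_elim (simp add: field_simps)
  ultimately have "(\<lambda>t. fact n * real (\<Sum>i\<le>t. h2 i) / real (t + e) ^ n) \<longlonglongrightarrow> c2"
    by (simp add: tendsto_cong)
  moreover have shift: "(\<Sum>i\<le>t + e. if e \<le> i then h2 (i - e) else 0) = (\<Sum>i\<le>t. h2 i)" for t
  proof -
    have "(\<Sum>i\<le>t + e. if e \<le> i then h2 (i - e) else 0) = (\<Sum>i\<in>{0 + e..t + e}. h2 (i - e))"
      by (intro sum.mono_neutral_cong_right) auto
    also have "\<dots> = (\<Sum>i\<in>{0..t}. h2 i)"
      by (subst sum.shift_bounds_cl_nat_ivl) simp
    finally show ?thesis by (simp add: atMost_atLeast0)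
  qed
  ultimately have "(\<lambda>t. ?f (\<lambda>i. if e \<le> i then h2 (i - e) else 0) (t + e)) \<longlonglongrightarrow> c2"
    by simp
  then have "?f (\<lambda>i. if e \<le> i then h2 (i - e) else 0) \<longlonglongrightarrow> c2"
    by (rule LIMSEQ_offset)
  then have "(\<lambda>t. ?f h1 t + ?f (\<lambda>i. if e \<le> i then h2 (i - e) else 0) t) \<longlonglongrightarrow> c1 + c2"
    using assms(1) unfolding has_multiplicity_def by (intro tendsto_add)
  then show ?thesis
    unfolding has_multiplicity_def h sum.distrib of_nat_add
    by (simp only: distrib_left add_divide_distrib)
qed

section \<open>Multiplicities of homogeneous ideals\<close>

definition prime_chain :: "nat \<Rightarrow> (nat \<Rightarrow> 'r::comm_ring_1 set) \<Rightarrow> bool"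
  where "prime_chain n P \<longleftrightarrow> (\<forall>i\<le>n. is_prime_ideal (P i)) \<and> (\<forall>i<n. P i \<subset> P (Suc i))"

lemma prime_chain_tl: "prime_chain (Suc n) P \<Longrightarrow> prime_chain n (\<lambda>i. P (Suc i))"
  by (simp add: prime_chain_def)

lemma prime_chain_Cons:
  assumes "prime_chain n P" "is_prime_ideal Q" "Q \<subset> P 0"
  shows "prime_chain (Suc n) (case_nat Q P)"
  using assms by (auto simp: prime_chain_def split: nat.splits)

context standard_graded_algebra
begin

text \<open>Noetherian induction in maximal-element form. By Zorn it suffices that the union of a
  chain is a member: the union is finitely generated, and some member contains all
  generators.\<close>

lemma maximal_ideal_in_family:
  assumes "\<A> \<noteq> {}" "\<And>I. I \<in> \<A> \<Longrightarrow> is_ideal (I :: 'r set)"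
  shows "\<exists>M\<in>\<A>. \<forall>X\<in>\<A>. M \<subseteq> X \<longrightarrow> X = M"
proof (rule subset_Zorn_nonempty[OF assms(1)])
  fix C assume C: "C \<noteq> {}" "subset.chain \<A> C"
  have CA: "C \<subseteq> \<A>" and lin: "\<And>X Y. X \<in> C \<Longrightarrow> Y \<in> C \<Longrightarrow> X \<subseteq> Y \<or> Y \<subseteq> X"
    using C(2) by (auto simp: subset_chain_def)
  have "is_ideal (\<Union>C)"
  proof (rule ideal.subspaceI)
    show "0 \<in> \<Union>C" using C CA assms(2) ideal.subspace_0 by blast
    show "x + y \<in> \<Union>C" if xy: "x \<in> \<Union>C" "y \<in> \<Union>C" for x y
    proof -
      obtain X Y where "X \<in> C" "Y \<in> C" "x \<in> X" "y \<in> Y" using xy by blast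
      then obtain Z where "Z \<in> C" "x \<in> Z" "y \<in> Z" using lin[of X Y] by blast
      then show ?thesis using CA assms(2) ideal.subspace_add by blast
    qed
    show "c * x \<in> \<Union>C" if "x \<in> \<Union>C" for c x
      using that CA assms(2) ideal.subspace_scale by blast
  qed
  then obtain S where S: "finite S" "\<Union>C = ideal_gen S" using noetherian by blast
  have "\<exists>X\<in>C. T \<subseteq> X" if "finite T" "T \<subseteq> \<Union>C" for T
    using that
  proof (induction T rule: finite_induct)
    case empty
    then show ?case using C by blast
  next
    case (insert t T)
    then obtain X Y where "X \<in> C" "T \<subseteq> X" "Y \<in> C" "t \<in> Y" by auto
    then show ?case using lin[of X Y] by blast
  qed
  then obtain X where X: "X \<in> C" "S \<subseteq> X" using S ideal.span_superset by metis
  then have "is_ideal X" using CA assms(2) by blast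
  then have "\<Union>C \<subseteq> X" unfolding S(2) using X by (intro ideal.span_minimal)
  then have "\<Union>C = X" using X by blast
  then show "\<Union>C \<in> \<A>" using X CA by blast
qed

lemma component_mult_sum:
  "component (a * b) t = (\<Sum>p\<le>t. component a p * component b (t - p))"
proof -
  let ?A = "{p. component a p \<noteq> 0} \<union> {..t}"
  have fin: "finite ?A" by (simp add: finite_component)
  have "a = (\<Sum>p\<in>?A. component a p)"
    by (rule sum_component_superset[OF fin]) auto
  then have "a * b = (\<Sum>p\<in>?A. component a p * b)"
    by (metis sum_distrib_right)
  then have "component (a * b) t = (\<Sum>p\<in>?A. if p \<le> t then component a p * component b (t - p) else 0)"
    by (simp add: component_sum component_mult[OF component_in] cong: if_cong)
  also have "\<dots> = (\<Sum>p\<le>t. component a p * component b (t - p))"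
    using fin by (intro sum.mono_neutral_cong_right) auto
  finally show ?thesis .
qed

lemma is_ideal_UNIV_iff: "is_ideal I \<Longrightarrow> I = UNIV \<longleftrightarrow> (1::'r) \<in> I"
  using ideal.subspace_scale[of I 1] by auto

text \<open>Primality of a homogeneous ideal can be tested on homogeneous elements: compare the
  lowest components of \<open>a\<close> and \<open>b\<close> outside \<open>I\<close>.\<close>

lemma homogeneous_prime:
  assumes I: "homogeneous_ideal I" "I \<noteq> UNIV"
    and prime: "\<And>f g s t. f \<in> R s \<Longrightarrow> g \<in> R t \<Longrightarrow> f * g \<in> I \<Longrightarrow> f \<in> I \<or> g \<in> I"
  shows "is_prime_ideal I"
  unfolding is_prime_ideal_def
proof (intro conjI allI impI)
  show id: "is_ideal I" "I \<noteq> UNIV" using I by (auto simp: homogeneous_ideal_def)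
  have least: "\<exists>i. component a i \<notin> I \<and> (\<forall>p<i. component a p \<in> I)" if "a \<notin> I" for a
  proof -
    have "\<exists>i. component a i \<notin> I"
    proof (rule ccontr)
      assume "\<nexists>i. component a i \<notin> I"
      then have "(\<Sum>t | component a t \<noteq> 0. component a t) \<in> I"
        by (intro ideal.subspace_sum[OF id(1)]) auto
      then show False using that sum_component[of a] by simp
    qed
    then show ?thesis using exists_least_iff[of "\<lambda>i. component a i \<notin> I"] by blast
  qed
  fix a b assume ab: "a * b \<in> I"
  show "a \<in> I \<or> b \<in> I"
  proof (rule ccontr)
    assume "\<not> (a \<in> I \<or> b \<in> I)"
    then obtain i j where i: "component a i \<notin> I" "\<And>p. p < i \<Longrightarrow> component a p \<in> I"
      and j: "component b j \<notin> I" "\<And>p. p < j \<Longrightarrow> component b p \<in> I"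
      using least[of a] least[of b] by blast
    \<comment> \<open>In degree \<open>i + j\<close> of the product, terms with \<open>p < i\<close>
      have the first factor in \<open>I\<close>, and terms with \<open>p > i\<close> the second.
      Only the term at \<open>i\<close> remains.\<close>
    let ?f = "\<lambda>p. component a p * component b (i + j - p)"
    have "component (a * b) (i + j) = ?f i + (\<Sum>p\<in>{..i + j} - {i}. ?f p)"
      unfolding component_mult_sum by (rule sum.remove) auto
    moreover have "(\<Sum>p\<in>{..i + j} - {i}. ?f p) \<in> I"
    proof (rule ideal.subspace_sum[OF id(1)])
      fix p assume p: "p \<in> {..i + j} - {i}"
      show "?f p \<in> I"
      proof (cases "p < i")
        case True
        then show ?thesis using i(2)[of p] ideal.subspace_scale[OF id(1)] by (simp add: mult.commute)
      next
        case False
        then have "i + j - p < j" using p by auto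
        then show ?thesis using j(2) ideal.subspace_scale[OF id(1)] by simp
      qed
    qed
    moreover have "component (a * b) (i + j) \<in> I"
      using ab I by (simp add: homogeneous_ideal_def)
    ultimately have "(?f i + (\<Sum>p\<in>{..i + j} - {i}. ?f p)) - (\<Sum>p\<in>{..i + j} - {i}. ?f p) \<in> I"
      using ideal.subspace_diff[OF id(1)] by metis
    then have "?f i \<in> I" by (simp only: add_diff_cancel_right')
    then have "component a i * component b j \<in> I" by simp
    then show False using prime[OF component_in component_in] i(1) j(1) by blast
  qed
qed

lemma hilbert_quotient_UNIV: "hilbert_quotient UNIV t = 0"
  using hilbert_quotient_eq[of UNIV t] by simp

text \<open>The chain accompanies the exponent so that the exponent can later be bounded by the
  Krull dimension. It starts above \<open>I\<close>, so a prime \<open>I\<close> strictly inside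
  \<open>P 0\<close> can be prepended.\<close>

lemma exists_chain_has_multiplicity:
  assumes "homogeneous_ideal I" "I \<noteq> UNIV"
  shows "\<exists>n P c. prime_chain n P \<and> I \<subseteq> P 0 \<and> has_multiplicity (hilbert_quotient I) n (real c)"
proof (rule ccontr)
  define good where "good I \<longleftrightarrow>
    (\<exists>n P c. prime_chain n P \<and> I \<subseteq> P 0 \<and> has_multiplicity (hilbert_quotient I) n (real c))" for I
  define \<A> where "\<A> = {I. homogeneous_ideal I \<and> I \<noteq> UNIV \<and> \<not> good I}"
  assume "\<nexists>n P c. prime_chain n P \<and> I \<subseteq> P 0 \<and> has_multiplicity (hilbert_quotient I) n (real c)"
  then have "\<A> \<noteq> {}" using assms by (auto simp: \<A>_def good_def)
  then have "\<exists>M\<in>\<A>. \<forall>X\<in>\<A>. M \<subseteq> X \<longrightarrow> X = M"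
    by (rule maximal_ideal_in_family) (simp add: \<A>_def homogeneous_ideal_def)
  then obtain M where M: "M \<in> \<A>" "\<And>X. X \<in> \<A> \<Longrightarrow> M \<subseteq> X \<Longrightarrow> X = M"
    by blast
  have hM: "homogeneous_ideal M" "M \<noteq> UNIV" "\<not> good M" using M(1) by (simp_all add: \<A>_def)
  then have idM: "is_ideal M" by (simp add: homogeneous_ideal_def)
  have larger: "good J" if "homogeneous_ideal J" "J \<noteq> UNIV" "M \<subset> J" for J
    using M(2)[of J] that by (auto simp: \<A>_def)
  have "is_prime_ideal M"
  proof (rule homogeneous_prime[OF hM(1,2)], rule ccontr)
    fix f g s t
    assume f: "f \<in> R s" and g: "g \<in> R t" and fg: "f * g \<in> M" "\<not> (f \<in> M \<or> g \<in> M)"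
    \<comment> \<open>If \<open>f * g\<close> witnesses that \<open>M\<close> is not prime, both
      \<open>?J\<close> and \<open>?K\<close> are strictly larger than \<open>M\<close>, as they
      contain \<open>f\<close> and \<open>g\<close> respectively.\<close>
    let ?J = "add_principal M f" and ?K = "colon M f"
    have "1 \<notin> ?K" "g \<in> ?K" using fg by (auto simp: colon_def)
    then have "?K \<noteq> UNIV" "M \<subset> ?K" using fg colon_superset[OF idM, of f] by auto
    then have "good ?K" using larger homogeneous_colon[OF hM(1) f] by blast
    then obtain n P c where K: "prime_chain n P" "?K \<subseteq> P 0"
      "has_multiplicity (hilbert_quotient ?K) n (real c)" unfolding good_def by blast
    \<comment> \<open>The two exponents may differ. The smaller is raised to the larger, which gives
      multiplicity 0 there, and the chain of the larger is kept.\<close>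
    have "\<exists>n' P' c1 c2. prime_chain n' P' \<and> M \<subseteq> P' 0 \<and>
      has_multiplicity (hilbert_quotient ?J) n' (real c1) \<and> has_multiplicity (hilbert_quotient ?K) n' (real c2)"
    proof (cases "?J = UNIV")
      case True
      then have "has_multiplicity (hilbert_quotient ?J) n (real 0)"
        using has_multiplicity_zero[of n] hilbert_quotient_UNIV by (simp add: has_multiplicity_def)
      then show ?thesis using K colon_superset[OF idM, of f] by blast
    next
      case False
      moreover have "M \<subset> ?J"
        using fg add_principal_superset[OF idM, of f] in_add_principal[OF idM, of f] by blast
      ultimately have "good ?J" using larger homogeneous_add_principal[OF hM(1) f] by blast
      then obtain n' P' c' where J: "prime_chain n' P'" "?J \<subseteq> P' 0"
        "has_multiplicity (hilbert_quotient ?J) n' (real c')" unfolding good_def by blast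
      show ?thesis
      proof (cases "n \<le> n'")
        case True
        then obtain c2 where "has_multiplicity (hilbert_quotient ?K) n' (real c2)"
          using has_multiplicity_mono_degree K by blast
        then show ?thesis using J add_principal_superset[OF idM, of f] by blast
      next
        case False
        then obtain c2 where "has_multiplicity (hilbert_quotient ?J) n (real c2)"
          using has_multiplicity_mono_degree[OF J(3), of n] by auto
        then show ?thesis using K colon_superset[OF idM, of f] by blast
      qed
    qed
    then obtain n' P' c1 c2 where *: "prime_chain n' P'" "M \<subseteq> P' 0"
      "has_multiplicity (hilbert_quotient ?J) n' (real c1)" "has_multiplicity (hilbert_quotient ?K) n' (real c2)"
      by blast
    have "has_multiplicity (hilbert_quotient M) n' (real c1 + real c2)"
      using *(3,4) hilbert_quotient_add_colon[OF hM(1) f] by (rule has_multiplicity_add_shift)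
    then have "has_multiplicity (hilbert_quotient M) n' (real (c1 + c2))" by simp
    then show False using * hM(3) unfolding good_def by blast
  qed
  show False
  proof (cases "R 1 \<subseteq> M")
    \<comment> \<open>Here \<open>R/M\<close> lives in degree 0 only, so the chain consisting of
      \<open>M\<close> alone suffices.\<close>
    case True
    have sub: "R (Suc t) \<subseteq> M" for t
    proof -
      have "{s * x |s x. s \<in> R 1 \<and> x \<in> R t} \<subseteq> M"
        using True ideal.subspace_scale[OF idM] by (auto simp: mult.commute)
      then show ?thesis unfolding component_Suc
        by (intro span_minimal ideal_imp_subspace[OF idM])
    qed
    have z: "hilbert_quotient M (Suc t) = 0" for t
      using hilbert_quotient_eq[OF idM, of "Suc t"] sub[of t] by (simp add: Int_absorb2)
    have "(\<Sum>i\<le>t. hilbert_quotient M i) = hilbert_quotient M 0" for t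
      by (induction t) (simp_all add: z)
    then have "has_multiplicity (hilbert_quotient M) 0 (real (hilbert_quotient M 0))"
      by (simp add: has_multiplicity_def)
    moreover have "prime_chain 0 (\<lambda>_. M)" using \<open>is_prime_ideal M\<close> by (simp add: prime_chain_def)
    ultimately show False using hM(3) unfolding good_def by blast
  next
    case False
    then obtain x where x: "x \<in> R 1" "x \<notin> M" by auto
    let ?J = "add_principal M x"
    have hJ: "homogeneous_ideal ?J" using hM(1) x(1) by (rule homogeneous_add_principal)
    have "M \<subset> ?J"
      using x add_principal_superset[OF idM, of x] in_add_principal[OF idM, of x] by blast
    \<comment> \<open>In degree 0 the multiples of \<open>x\<close> vanish, so 1 in
      \<open>?J\<close> would mean 1 in \<open>M\<close>.\<close>
    have "?J \<noteq> UNIV"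
    proof
      assume "?J = UNIV"
      then obtain m r where m: "m \<in> M" "1 = m + x * r" unfolding add_principal_def by blast
      have "1 = component 1 0" using one_in_R0 by (simp add: component_homogeneous)
      also have "\<dots> = component m 0"
        unfolding m(2) component_add component_mult[OF x(1)] by simp
      also have "\<dots> \<in> M" using m hM(1) by (simp add: homogeneous_ideal_def)
      finally show False using is_ideal_UNIV_iff[OF idM] hM(2) by simp
    qed
    then obtain n P c where J: "prime_chain n P" "?J \<subseteq> P 0"
      "has_multiplicity (hilbert_quotient ?J) n (real c)"
      using larger[OF hJ] \<open>M \<subset> ?J\<close> unfolding good_def by blast
    \<comment> \<open>As \<open>x\<close> is a nonzerodivisor modulo the prime \<open>M\<close>, the
      exact sequence expresses each value for \<open>M\<close> as the preceding one plus the value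
      for \<open>?J\<close>.\<close>
    have colon: "colon M x = M"
      using \<open>is_prime_ideal M\<close> x colon_superset[OF idM, of x]
      unfolding colon_def is_prime_ideal_def by auto
    have "hilbert_quotient M t = (\<Sum>i\<le>t. hilbert_quotient ?J i)" for t
    proof (induction t)
      case 0
      then show ?case using hilbert_quotient_add_colon[OF hM(1) x(1), of 0] by simp
    next
      case (Suc t)
      then show ?case using hilbert_quotient_add_colon[OF hM(1) x(1), of "Suc t"] colon by simp
    qed
    then have "hilbert_quotient M = (\<lambda>t. \<Sum>i\<le>t. hilbert_quotient ?J i)" by auto
    then have "has_multiplicity (hilbert_quotient M) (Suc n) (real c)"
      using has_multiplicity_partial_sums[OF J(3)] by simp
    moreover have "prime_chain (Suc n) (case_nat M P)"
      using J(1) \<open>is_prime_ideal M\<close> by (rule prime_chain_Cons) (use \<open>M \<subset> ?J\<close> J(2) in blast)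
    ultimately show False using hM(3) unfolding good_def
      by (metis nat.case(1) order_refl)
  qed
qed

section \<open>Finiteness of the Krull dimension\<close>

text \<open>Primes in a chain need not be homogeneous, so the Krull dimension is bounded through
  this filtration by degree instead of the grading.\<close>

definition degree_le :: "nat \<Rightarrow> 'r set"
  where "degree_le t = {r. \<forall>i>t. component r i = 0}"

lemma subspace_degree_le: "subspace (degree_le t)"
  unfolding degree_le_def subspace_def by (auto simp: component_add component_scale)

lemma degree_le_exists: "\<exists>e. r \<in> degree_le e"
proof -
  obtain e where e: "\<And>i. component r i \<noteq> 0 \<Longrightarrow> i \<le> e"
    using finite_component[of r] by (auto simp: finite_nat_set_iff_bounded_le)
  have "component r i = 0" if "i > e" for i using e[of i] that by linarith
  then have "r \<in> degree_le e" by (simp add: degree_le_def)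
  then show ?thesis ..
qed

lemma one_in_degree_le: "1 \<in> degree_le t"
  using one_in_R0 by (simp add: degree_le_def component_homogeneous)

lemma degree_le_mult:
  assumes "a \<in> degree_le s" "b \<in> degree_le t"
  shows "a * b \<in> degree_le (s + t)"
proof -
  have "component a p * component b (i - p) = 0" if "s + t < i" "p \<le> i" for i p
  proof -
    have "s < p \<or> t < i - p" using that by auto
    then show ?thesis using assms by (auto simp: degree_le_def)
  qed
  then show ?thesis by (auto simp: degree_le_def component_mult_sum)
qed

lemma degree_le_Suc: "degree_le (Suc t) = {x + y |x y. x \<in> degree_le t \<and> y \<in> R (Suc t)}"
proof
  show "degree_le (Suc t) \<subseteq> {x + y |x y. x \<in> degree_le t \<and> y \<in> R (Suc t)}"
  proof
    fix r assume r: "r \<in> degree_le (Suc t)"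
    let ?y = "component r (Suc t)"
    have c: "component (r - ?y) i = component r i - component ?y i" for i
      using component_add[of "r - ?y" ?y i] by simp
    have "r - ?y \<in> degree_le t"
      using r unfolding degree_le_def
      by (auto simp: c component_homogeneous[OF component_in])
    then have "(r - ?y) + ?y \<in> {x + y |x y. x \<in> degree_le t \<and> y \<in> R (Suc t)}"
      using component_in by blast
    then show "r \<in> {x + y |x y. x \<in> degree_le t \<and> y \<in> R (Suc t)}" by simp
  qed
  show "{x + y |x y. x \<in> degree_le t \<and> y \<in> R (Suc t)} \<subseteq> degree_le (Suc t)"
    by (auto simp: degree_le_def component_add component_homogeneous)
qed

lemma degree_le_0: "degree_le 0 = R 0"
proof
  show "degree_le 0 \<subseteq> R 0"
  proof
    fix r assume "r \<in> degree_le 0"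
    then have "r = (\<Sum>t\<in>{0}. component r t)"
      by (intro sum_component_superset) (auto simp: degree_le_def)
    then show "r \<in> R 0" using component_in[of r 0] by simp
  qed
  show "R 0 \<subseteq> degree_le 0" by (auto simp: degree_le_def component_homogeneous)
qed

lemma fin_dim_degree_le: "fin_dim (degree_le t)"
  by (induction t) (auto simp: degree_le_0 degree_le_Suc fin_dim_component intro: fin_dim_sums)

lemma dim_degree_le: "dim (degree_le t) \<le> (\<Sum>i\<le>t. dim (R i))"
proof (induction t)
  case (Suc t)
  have "dim (degree_le (Suc t)) \<le> dim (degree_le t) + dim (R (Suc t))"
    using dim_sums_add_Int[OF subspace_component[of "Suc t"] subspace_degree_le[of t]
        fin_dim_component fin_dim_degree_le] unfolding degree_le_Suc by simp
  then show ?case using Suc by simp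
qed (simp add: degree_le_0)

text \<open>The affine Hilbert function: the dimension of the image of \<open>degree_le t\<close> in
  the quotient by \<open>I\<close>.\<close>

definition filtered_dim :: "'r set \<Rightarrow> nat \<Rightarrow> nat"
  where "filtered_dim I t = dim (degree_le t) - dim (degree_le t \<inter> I)"

lemma filtered_dim_eq: "filtered_dim I t + dim (degree_le t \<inter> I) = dim (degree_le t)"
  unfolding filtered_dim_def using fin_dim_dim_mono[OF fin_dim_degree_le[of t], of "degree_le t \<inter> I"] by simp

text \<open>Modulo \<open>P\<close>, multiplication by \<open>f\<close> is injective and lands in
  \<open>Q\<close>. It thus embeds the degree \<open>t\<close> layer for \<open>P\<close> into the
  kernel of the map from the quotient by \<open>P\<close> to that by \<open>Q\<close>, in degree
  \<open>t + e\<close>.\<close>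

lemma filtered_dim_step:
  assumes "is_prime_ideal P" "is_ideal Q" "P \<subseteq> Q" "f \<in> Q" "f \<notin> P" "f \<in> degree_le e"
  shows "filtered_dim Q (t + e) + filtered_dim P t \<le> filtered_dim P (t + e)"
proof -
  have P: "is_ideal P" using assms by (simp add: is_prime_ideal_def)
  let ?W = "degree_le (t + e) \<inter> P"
  have mult: "f * u \<in> degree_le (t + e)" if "u \<in> degree_le t" for u
    using degree_le_mult[OF assms(6) that] by (simp add: add.commute)
  have "{u \<in> degree_le t. f * u \<in> ?W} = degree_le t \<inter> P"
    using mult assms ideal.subspace_scale[OF P] unfolding is_prime_ideal_def by auto
  moreover have "subspace ?W"
    by (intro subspace_inter subspace_degree_le ideal_imp_subspace P)
  moreover have "fin_dim ?W"
    using fin_dim_degree_le[of "t + e"] by (rule fin_dim_subset) simp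
  ultimately have "dim {x + y |x y. x \<in> ?W \<and> y \<in> (*) f ` degree_le t} + dim (degree_le t \<inter> P)
      = dim ?W + dim (degree_le t)"
    using dim_plus_image[OF linear_mult subspace_degree_le _ fin_dim_degree_le, of ?W f t] by simp
  moreover have "{x + y |x y. x \<in> ?W \<and> y \<in> (*) f ` degree_le t} \<subseteq> degree_le (t + e) \<inter> Q"
  proof clarify
    fix x u assume "x \<in> degree_le (t + e)" "x \<in> P" "u \<in> degree_le t"
    moreover have "u * f \<in> Q" using ideal.subspace_scale[OF assms(2,4)] .
    ultimately show "x + f * u \<in> degree_le (t + e) \<inter> Q"
      using mult[of u] assms(3) subspace_add[OF subspace_degree_le] ideal.subspace_add[OF assms(2)]
      by (auto simp: mult.commute[of u f])
  qed
  then have "dim {x + y |x y. x \<in> ?W \<and> y \<in> (*) f ` degree_le t} \<le> dim (degree_le (t + e) \<inter> Q)"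
    by (rule fin_dim_dim_mono[rotated]) (rule fin_dim_subset[OF fin_dim_degree_le[of "t + e"]], simp)
  ultimately show ?thesis
    using filtered_dim_eq[of Q "t + e"] filtered_dim_eq[of P t] filtered_dim_eq[of P "t + e"] by linarith
qed

lemma filtered_dim_mono:
  assumes "is_prime_ideal P" "s \<le> t"
  shows "filtered_dim P s \<le> filtered_dim P t"
  using assms(2)
proof (induction t rule: dec_induct)
  case (step t)
  have "1 \<notin> P" using assms is_ideal_UNIV_iff[of P] by (auto simp: is_prime_ideal_def)
  \<comment> \<open>The step lemma is applied with \<open>Q\<close> the whole ring and
    \<open>f = 1\<close>, viewed as an element of degree at most 1.\<close>
  then have "filtered_dim P t \<le> filtered_dim P (t + 1)"
    using filtered_dim_step[OF assms(1), of UNIV 1 1 t] one_in_degree_le by simp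
  then show ?case using step by simp
qed simp

lemma filtered_dim_pos:
  assumes "is_prime_ideal P"
  shows "filtered_dim P t > 0"
proof (rule ccontr)
  assume "\<not> filtered_dim P t > 0"
  then have "dim (degree_le t) \<le> dim (degree_le t \<inter> P)" using filtered_dim_eq[of P t] by simp
  moreover have "subspace (degree_le t \<inter> P)"
    using assms by (intro subspace_inter subspace_degree_le ideal_imp_subspace) (simp add: is_prime_ideal_def)
  ultimately have "degree_le t \<inter> P = degree_le t"
    using fin_dim_degree_le by (intro fin_dim_dim_eq) auto
  then have "1 \<in> P" using one_in_degree_le[of t] by blast
  then show False using assms is_ideal_UNIV_iff[of P] by (auto simp: is_prime_ideal_def)
qed

text \<open>Each of \<open>m\<close> applications of the step gains a summand that is at least
  \<open>filtered_dim Q t\<close> by monotonicity.\<close>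

lemma filtered_dim_iterate:
  assumes "is_prime_ideal P" "is_prime_ideal Q" "P \<subset> Q"
  obtains e where "\<And>m t. m * filtered_dim Q t \<le> filtered_dim P (t + m * e)"
proof -
  obtain f where f: "f \<in> Q" "f \<notin> P" using assms by blast
  obtain e where e: "f \<in> degree_le e" using degree_le_exists by blast
  have Q: "is_ideal Q" using assms by (simp add: is_prime_ideal_def)
  have "m * filtered_dim Q t \<le> filtered_dim P (t + m * e)" for m t
  proof (induction m)
    case (Suc m)
    have "filtered_dim Q t \<le> filtered_dim Q (t + m * e + e)"
      using assms by (intro filtered_dim_mono) auto
    moreover have "filtered_dim Q (t + m * e + e) + filtered_dim P (t + m * e) \<le> filtered_dim P (t + m * e + e)"
      using filtered_dim_step[OF assms(1) Q _ f e] assms by blast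
    ultimately show ?case using Suc by (simp add: add.assoc add.commute[of e])
  qed simp
  then show thesis by (rule that)
qed

text \<open>Taking \<open>m = t + 1\<close> in the iterated inequality lowers the exponent of the
  bound by one when passing from \<open>P 0\<close> to \<open>P 1\<close>; with exponent 0 no strict
  inclusion is possible.\<close>

lemma prime_chain_length_le:
  assumes "prime_chain n P" "\<And>t. filtered_dim (P 0) t \<le> C * (t + 1) ^ k"
  shows "n \<le> k"
  using assms
proof (induction k arbitrary: n P C)
  case 0
  show ?case
  proof (rule ccontr)
    assume "\<not> n \<le> 0"
    then have *: "is_prime_ideal (P 0)" "is_prime_ideal (P 1)" "P 0 \<subset> P 1"
      using 0 unfolding prime_chain_def by (auto simp: Suc_le_eq)
    obtain e where "\<And>m t. m * filtered_dim (P 1) t \<le> filtered_dim (P 0) (t + m * e)"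
      using filtered_dim_iterate[OF *] by blast
    \<comment> \<open>The choice \<open>m = C + 1\<close>, \<open>t = 0\<close> exceeds the constant
      bound, because \<open>filtered_dim (P 1) 0\<close> is positive.\<close>
    then have "(C + 1) * filtered_dim (P 1) 0 \<le> C" using 0(2) by (metis le_trans power_0 mult_1_right)
    moreover have "(C + 1) * 1 \<le> (C + 1) * filtered_dim (P 1) 0"
      using filtered_dim_pos[OF *(2), of 0] by (intro mult_le_mono2) simp
    ultimately show False by simp
  qed
next
  case (Suc k)
  show ?case
  proof (cases n)
    case (Suc n')
    then have *: "is_prime_ideal (P 0)" "is_prime_ideal (P 1)" "P 0 \<subset> P 1"
      using Suc.prems unfolding prime_chain_def by auto
    obtain e where e: "\<And>m t. m * filtered_dim (P 1) t \<le> filtered_dim (P 0) (t + m * e)"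
      using filtered_dim_iterate[OF *] by blast
    have "filtered_dim (P 1) t \<le> (C * (e + 1) ^ Suc k) * (t + 1) ^ k" for t
    proof -
      have "(t + 1) * filtered_dim (P 1) t \<le> C * (t + (t + 1) * e + 1) ^ Suc k"
        using e Suc.prems(2) le_trans by blast
      also have "t + (t + 1) * e + 1 = (t + 1) * (e + 1)" by (simp add: algebra_simps)
      also have "C * ((t + 1) * (e + 1)) ^ Suc k = (t + 1) * ((C * (e + 1) ^ Suc k) * (t + 1) ^ k)"
        by (simp only: power_mult_distrib power_Suc ac_simps)
      finally show ?thesis by (metis nat_mult_le_cancel1 zero_less_Suc Suc_eq_plus1)
    qed
    moreover have "prime_chain n' (\<lambda>i. P (Suc i))"
      using Suc.prems Suc by (intro prime_chain_tl) simp
    ultimately have "n' \<le> k"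
      by (intro Suc.IH[of n' "\<lambda>i. P (Suc i)" "C * (e + 1) ^ Suc k"]) (simp_all only: One_nat_def)
    then show ?thesis using Suc by simp
  qed simp
qed

end

section \<open>Growth of subspaces under multiplication by linear forms\<close>

lemma power_regular_mod:
  fixes a b r :: "'r::comm_ring_1"
  assumes "\<And>r. r * b \<in> range ((*) a) \<Longrightarrow> r \<in> range ((*) a)" "r * b ^ s \<in> range ((*) a)"
  shows "r \<in> range ((*) a)"
  using assms(2)
proof (induction s arbitrary: r)
  case (Suc s)
  then have "(r * b) * b ^ s \<in> range ((*) a)" by (simp add: mult.assoc)
  then show ?case using Suc.IH assms(1) by blast
qed simp

text \<open>Induction on \<open>k\<close>: \<open>r\<close> is a multiple of \<open>a\<close> by the
  case of exponent 1, and the nonzerodivisor \<open>a\<close> can be cancelled.\<close>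

lemma power_regular_mod_power:
  fixes a b r :: "'r::comm_ring_1"
  assumes a: "\<And>r. r * a = 0 \<Longrightarrow> r = 0"
    and b: "\<And>r. r * b \<in> range ((*) a) \<Longrightarrow> r \<in> range ((*) a)" and "r * b ^ s \<in> range ((*) (a ^ k))"
  shows "r \<in> range ((*) (a ^ k))"
  using assms(3)
proof (induction k arbitrary: r)
  case (Suc k)
  then obtain q where q: "r * b ^ s = a * (a ^ k * q)" by (auto simp: mult.assoc)
  then have "r \<in> range ((*) a)" using b by (intro power_regular_mod[of b a r s]) auto
  then obtain r' where r': "r = a * r'" by blast
  have "(r' * b ^ s - a ^ k * q) * a = r * b ^ s - a * (a ^ k * q)"
    unfolding r' by (simp add: algebra_simps)
  then have "(r' * b ^ s - a ^ k * q) * a = 0" using q by simp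
  then have "r' * b ^ s - a ^ k * q = 0" by (rule a)
  then have "r' * b ^ s = a ^ k * q" by simp
  then have "r' \<in> range ((*) (a ^ k))" using Suc.IH[of r'] by auto
  then show ?case using r' by (auto simp: mult.assoc)
qed simp

lemma power_cancel_regular:
  fixes a r :: "'r::comm_ring_1"
  assumes "\<And>r. r * a = 0 \<Longrightarrow> r = 0" "r * a ^ k = 0"
  shows "r = 0"
  using assms(2)
proof (induction k arbitrary: r)
  case (Suc k)
  then have "(r * a) * a ^ k = 0" by (simp add: mult.assoc)
  then show ?case using Suc.IH assms(1) by blast
qed simp

lemma ideal_annihilator: "is_ideal (annihilator F)"
  unfolding annihilator_def
  by (rule ideal.subspaceI) (auto simp: distrib_right mult.assoc)

lemma annihilator_ideal_gen: "annihilator F \<subseteq> annihilator (ideal_gen F)"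
proof
  fix r assume "r \<in> annihilator F"
  then have "F \<subseteq> {f. r * f = 0}" by (auto simp: annihilator_def)
  moreover have "is_ideal {f. r * f = 0}"
    by (rule ideal.subspaceI) (auto simp: distrib_left mult.left_commute[of r])
  ultimately have "ideal_gen F \<subseteq> {f. r * f = 0}" by (rule ideal.span_minimal)
  then show "r \<in> annihilator (ideal_gen F)" by (auto simp: annihilator_def)
qed

context standard_graded_algebra
begin

text \<open>An annihilator that is maximal among those of nonzero multiples of \<open>v\<close> is
  prime. Reducedness keeps \<open>v\<close> outside, since otherwise
  \<open>(v * h) ^ 2 = 0\<close>.\<close>

lemma annihilator_prime:
  fixes v :: 'r
  assumes reduced: "\<And>x::'r. x ^ 2 = 0 \<Longrightarrow> x = 0" and "v \<noteq> 0"
  obtains h where "is_prime_ideal (annihilator {v * h})" "v \<notin> annihilator {v * h}"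
proof -
  define \<A> where "\<A> = {annihilator {v * h} |h. v * h \<noteq> 0}"
  have "annihilator {v * 1} \<in> \<A>"
    unfolding \<A>_def by (intro CollectI exI[of _ 1]) (use assms(2) in simp)
  then have "\<exists>M\<in>\<A>. \<forall>X\<in>\<A>. M \<subseteq> X \<longrightarrow> X = M"
    by (intro maximal_ideal_in_family) (auto simp: \<A>_def ideal_annihilator)
  then obtain M where M: "M \<in> \<A>" "\<And>X. X \<in> \<A> \<Longrightarrow> M \<subseteq> X \<Longrightarrow> X = M" by blast
  then obtain h where h: "v * h \<noteq> 0" "M = annihilator {v * h}" by (auto simp: \<A>_def)
  have maximal: "annihilator {v * k} = annihilator {v * h}"
    if "v * k \<noteq> 0" "annihilator {v * h} \<subseteq> annihilator {v * k}" for k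
    using M(2)[of "annihilator {v * k}"] that unfolding h(2) \<A>_def by auto
  show thesis
  proof (rule that)
    show "is_prime_ideal (annihilator {v * h})"
      unfolding is_prime_ideal_def
    proof (intro conjI allI impI)
      show "is_ideal (annihilator {v * h})" by (rule ideal_annihilator)
      have "1 \<notin> annihilator {v * h}" using h by (simp add: annihilator_def)
      then show "annihilator {v * h} \<noteq> UNIV" by blast
      fix a b assume ab: "a * b \<in> annihilator {v * h}"
      show "a \<in> annihilator {v * h} \<or> b \<in> annihilator {v * h}"
      proof (rule disjCI)
        assume "b \<notin> annihilator {v * h}"
        then have "v * (h * b) \<noteq> 0" by (simp add: annihilator_def ac_simps)
        moreover have "annihilator {v * h} \<subseteq> annihilator {v * (h * b)}"
          by (auto simp: annihilator_def simp flip: mult.assoc)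
        ultimately have "annihilator {v * (h * b)} = annihilator {v * h}" by (rule maximal)
        moreover have "a \<in> annihilator {v * (h * b)}" using ab by (simp add: annihilator_def ac_simps)
        ultimately show "a \<in> annihilator {v * h}" by simp
      qed
    qed
    show "v \<notin> annihilator {v * h}"
    proof
      assume "v \<in> annihilator {v * h}"
      then have "(v * h) ^ 2 = h * (v * (v * h))" by (simp add: power2_eq_square ac_simps)
      then have "(v * h) ^ 2 = 0" using \<open>v \<in> annihilator {v * h}\<close> by (simp add: annihilator_def)
      then show False using reduced h(1) by blast
    qed
  qed
qed

text \<open>Elements of a regular sequence in \<open>maximal_ideal\<close> need not be homogeneous;
  what their \<open>s\<close>-th powers retain is order at least \<open>s\<close>.\<close>

definition order_ge :: "nat \<Rightarrow> 'r set"
  where "order_ge s = {r. \<forall>i<s. component r i = 0}"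

lemma order_ge_mult:
  assumes "a \<in> order_ge s" "b \<in> order_ge t"
  shows "a * b \<in> order_ge (s + t)"
proof -
  have "component a p * component b (i - p) = 0" if "i < s + t" "p \<le> i" for i p
  proof -
    have "p < s \<or> i - p < t" using that by auto
    then show ?thesis using assms by (auto simp: order_ge_def)
  qed
  then show ?thesis by (auto simp: order_ge_def component_mult_sum)
qed

lemma order_ge_power: "a \<in> order_ge s \<Longrightarrow> a ^ n \<in> order_ge (n * s)"
proof (induction n)
  case (Suc n)
  then show ?case using order_ge_mult[of a s "a ^ n" "n * s"] by simp
qed (simp add: order_ge_def)

lemma component_subset_order_ge: "s \<le> t \<Longrightarrow> R t \<subseteq> order_ge s"
  by (auto simp: order_ge_def component_homogeneous)

lemma maximal_ideal_subset_order_ge: "maximal_ideal \<subseteq> order_ge 1"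
  unfolding maximal_ideal_def
proof (rule span_minimal)
  show "(\<Union>t\<in>{1..}. R t) \<subseteq> order_ge 1" using component_subset_order_ge by fastforce
  show "subspace (order_ge 1)"
    by (auto simp: order_ge_def subspace_def component_add component_scale)
qed

text \<open>The first two members of a regular sequence of length at least two; such a sequence
  exists, as otherwise the supremum would be at most 1.\<close>

lemma depth_ge_2:
  assumes "depth \<ge> 2"
  obtains a b where "a \<in> maximal_ideal" "b \<in> maximal_ideal" "\<And>r. r * a = 0 \<Longrightarrow> r = 0"
    "\<And>r. r * b \<in> range ((*) a) \<Longrightarrow> r \<in> range ((*) a)"
proof -
  have "\<exists>xs. regular_sequence xs \<and> set xs \<subseteq> maximal_ideal \<and> length xs \<ge> 2"
  proof (rule ccontr)
    assume none: "\<nexists>xs. regular_sequence xs \<and> set xs \<subseteq> maximal_ideal \<and> length xs \<ge> 2"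
    have "depth \<le> 1"
      unfolding depth_def depth_wrt_def
    proof (rule Sup_least, clarify)
      fix xs assume "regular_sequence xs" "set xs \<subseteq> maximal_ideal"
      then have "length xs \<le> 1" using none by force
      then show "enat (length xs) \<le> 1" by (simp add: one_enat_def)
    qed
    with assms have "(2::enat) \<le> 1" by (rule order.trans)
    then show False by (simp add: one_enat_def numeral_eq_enat)
  qed
  then obtain xs where xs: "regular_sequence xs" "set xs \<subseteq> maximal_ideal" "length xs \<ge> 2" by blast
  then obtain a b ys where ab: "xs = a # b # ys"
    by (cases xs; cases "tl xs") auto
  have reg: "\<And>i r. i < length xs \<Longrightarrow> r * xs ! i \<in> ideal_gen (set (take i xs)) \<Longrightarrow> r \<in> ideal_gen (set (take i xs))"
    using xs(1) unfolding regular_sequence_def by blast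
  have gen: "ideal_gen {a} = range ((*) a)"
    unfolding ideal.span_singleton by (simp add: mult.commute)
  show thesis
  proof (rule that[of a b])
    show "a \<in> maximal_ideal" "b \<in> maximal_ideal" using xs ab by auto
    show "r = 0" if "r * a = 0" for r using reg[of 0 r] that ab by simp
    show "r \<in> range ((*) a)" if "r * b \<in> range ((*) a)" for r
      using reg[of 1 r] that ab gen by simp
  qed
qed

text \<open>Iterating the negated inclusion would give \<open>R s * v \<subseteq> x ^ s * V + P\<close> for all \<open>s\<close>; the powers
  \<open>a ^ s\<close>, \<open>b ^ s\<close> of a regular sequence then force \<open>v * g\<close> into \<open>x ^ s\<close> times the ring for all \<open>s\<close>,
  hence \<open>v * g = 0\<close>.\<close>

lemma linear_forms_mult_not_subset:
  assumes depth: "depth \<ge> 2" and V: "subspace V" "v \<in> V" "v \<notin> annihilator {g}"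
    and P: "is_prime_ideal (annihilator {g})" and x: "x \<in> R 1" "x \<notin> annihilator {g}"
  shows "\<exists>y\<in>R 1. \<exists>w\<in>V. \<forall>u\<in>V. y * w - x * u \<notin> annihilator {g}"
proof (rule ccontr)
  assume "\<not> ?thesis"
  \<comment> \<open>Congruence modulo \<open>annihilator {g}\<close> is equality after
    multiplication by \<open>g\<close>.\<close>
  then have step: "\<exists>u\<in>V. y * w * g = x * u * g" if "y \<in> R 1" "w \<in> V" for y w
    using that by (force simp: annihilator_def algebra_simps)
  obtain a b where a: "a \<in> maximal_ideal" "\<And>r. r * a = 0 \<Longrightarrow> r = 0"
    and b: "b \<in> maximal_ideal" "\<And>r. r * b \<in> range ((*) a) \<Longrightarrow> r \<in> range ((*) a)"
    using depth_ge_2[OF depth] by metis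
  have homog: "\<exists>u\<in>V. r * w * g = x ^ s * u * g" if "r \<in> R s" "w \<in> V" for r s w
    using that
  proof (induction s arbitrary: r w)
    case 0
    then obtain c where "r = scale c 1" unfolding component_0 by blast
    then have "r * w * g = x ^ 0 * scale c w * g" by (simp flip: scale_mult)
    then show ?case using subspace_scale[OF V(1) 0(2)] by blast
  next
    case (Suc s)
    \<comment> \<open>As \<open>?T\<close> is a subspace, only products \<open>y * r\<close> have to
      be checked; for them \<open>step\<close> supplies one more factor \<open>x\<close>.\<close>
    let ?T = "{z. \<forall>w\<in>V. \<exists>u\<in>V. z * w * g = x ^ Suc s * u * g}"
    have "{y * r |y r. y \<in> R 1 \<and> r \<in> R s} \<subseteq> ?T"
    proof clarify
      fix y r w assume *: "y \<in> R 1" "r \<in> R s" "w \<in> V"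
      obtain u where u: "u \<in> V" "r * w * g = x ^ s * u * g" using Suc.IH * by blast
      obtain u' where u': "u' \<in> V" "y * u * g = x * u' * g" using step * u by blast
      have "y * r * w * g = y * (r * w * g)" by (simp add: ac_simps)
      also have "\<dots> = x ^ s * (y * u * g)" unfolding u by (simp add: ac_simps)
      also have "\<dots> = x ^ Suc s * u' * g" unfolding u' by (simp add: ac_simps)
      finally show "\<exists>u\<in>V. y * r * w * g = x ^ Suc s * u * g" using u' by blast
    qed
    moreover have "subspace ?T"
    proof (rule subspaceI)
      show "0 \<in> ?T" using subspace_0[OF V(1)] by (auto intro!: bexI[of _ 0])
      show "z + z' \<in> ?T" if T: "z \<in> ?T" "z' \<in> ?T" for z z'
      proof clarify
        fix w assume "w \<in> V"
        then obtain u u' where "u \<in> V" "z * w * g = x ^ Suc s * u * g" "u' \<in> V" "z' * w * g = x ^ Suc s * u' * g"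
          using T by blast
        then show "\<exists>u\<in>V. (z + z') * w * g = x ^ Suc s * u * g"
          using subspace_add[OF V(1)] by (intro bexI[of _ "u + u'"]) (simp_all only: distrib_left distrib_right)
      qed
      show "scale c z \<in> ?T" if T: "z \<in> ?T" for c z
      proof clarify
        fix w assume "w \<in> V"
        then obtain u where "u \<in> V" "z * w * g = x ^ Suc s * u * g" using T by blast
        moreover have "scale c z * w * g = scale c (z * w * g)" by (simp add: scale_mult)
        moreover have "x ^ Suc s * scale c u * g = scale c (x ^ Suc s * u * g)"
          by (simp only: scale_mult mult_scale)
        ultimately show "\<exists>u\<in>V. scale c z * w * g = x ^ Suc s * u * g"
          using subspace_scale[OF V(1)] by (intro bexI[of _ "scale c u"]) simp_all
      qed
    qed
    ultimately have "R (Suc s) \<subseteq> ?T" unfolding component_Suc by (rule span_minimal)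
    then show ?case using Suc.prems by blast
  qed
  \<comment> \<open>Every component of \<open>r\<close> has degree at least \<open>s\<close>, so
    \<open>homog\<close> gives at least \<open>s\<close> factors \<open>x\<close>, of which
    \<open>s\<close> are split off.\<close>
  have order: "\<exists>q. r * v * g = x ^ s * q * g" if "r \<in> order_ge s" for r s
  proof -
    have "\<exists>q. component r i * v * g = x ^ s * q * g" for i
    proof (cases "i < s")
      case True
      then have "component r i * v * g = x ^ s * 0 * g" using that by (simp add: order_ge_def)
      then show ?thesis by blast
    next
      case False
      then have "x ^ i = x ^ s * x ^ (i - s)" by (simp flip: power_add)
      moreover obtain u where "component r i * v * g = x ^ i * u * g"
        using homog[OF component_in V(2)] by blast
      ultimately have "component r i * v * g = x ^ s * (x ^ (i - s) * u) * g" by (simp add: mult.assoc)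
      then show ?thesis by blast
    qed
    then obtain q where q: "\<And>i. component r i * v * g = x ^ s * q i * g" by metis
    have "r * v * g = (\<Sum>i | component r i \<noteq> 0. component r i * v * g)"
      by (subst sum_component[of r]) (simp add: sum_distrib_right)
    also have "\<dots> = x ^ s * (\<Sum>i | component r i \<noteq> 0. q i) * g"
      unfolding q by (simp add: sum_distrib_right sum_distrib_left)
    finally show ?thesis by blast
  qed
  have xs: "r \<in> annihilator {g}" if "x ^ s * r \<in> annihilator {g}" for r s
    using that
  proof (induction s)
    case (Suc s)
    then have "x * (x ^ s * r) \<in> annihilator {g}" by (simp add: mult.assoc)
    then have "x ^ s * r \<in> annihilator {g}" using P x(2) unfolding is_prime_ideal_def by blast
    then show ?case by (rule Suc.IH)
  qed simp
  have "v * g \<in> order_ge s" for s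
  proof -
    have "a ^ s \<in> order_ge s" "b ^ s \<in> order_ge s"
      using order_ge_power[of a 1 s] order_ge_power[of b 1 s] maximal_ideal_subset_order_ge a(1) b(1) by auto
    then obtain q q' where q: "a ^ s * v * g = x ^ s * q * g" "b ^ s * v * g = x ^ s * q' * g"
      using order by blast
    \<comment> \<open>Eliminating \<open>v * g\<close> from the two equations and cancelling
      \<open>x ^ s\<close> modulo the prime leaves \<open>q * g * b ^ s = a ^ s * q' * g\<close>.
      Regularity then makes \<open>q * g\<close> divisible by \<open>a ^ s\<close>.\<close>
    have "x ^ s * (a ^ s * q' - b ^ s * q) * g = a ^ s * (x ^ s * q' * g) - b ^ s * (x ^ s * q * g)"
      by (simp add: algebra_simps)
    also have "\<dots> = a ^ s * (b ^ s * v * g) - b ^ s * (a ^ s * v * g)" unfolding q ..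
    also have "\<dots> = 0" by (simp add: ac_simps)
    finally have "x ^ s * (a ^ s * q' - b ^ s * q) \<in> annihilator {g}" by (simp add: annihilator_def)
    then have "a ^ s * q' - b ^ s * q \<in> annihilator {g}" by (rule xs)
    then have "(q * g) * b ^ s = a ^ s * (q' * g)" by (simp add: annihilator_def algebra_simps)
    then have "(q * g) * b ^ s \<in> range ((*) (a ^ s))" by (rule range_eqI)
    then have "q * g \<in> range ((*) (a ^ s))" using power_regular_mod_power[of a b "q * g" s s] a(2) b(2) by blast
    then obtain h where h: "q * g = a ^ s * h" by blast
    have "(v * g - x ^ s * h) * a ^ s = a ^ s * v * g - x ^ s * (a ^ s * h)"
      by (simp add: algebra_simps)
    also have "\<dots> = 0" using q(1) unfolding h[symmetric] by (simp add: mult.assoc)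
    finally have "v * g - x ^ s * h = 0" using power_cancel_regular[of a "v * g - x ^ s * h" s] a(2) by blast
    then have "v * g = x ^ s * h" by simp
    moreover have "x ^ s * h \<in> order_ge (s + 0)"
      using order_ge_power[of x 1 s] component_subset_order_ge[of 1 1] x(1)
      by (intro order_ge_mult) (auto simp: order_ge_def)
    ultimately show ?thesis by simp
  qed
  then have "component (v * g) i = 0" for i by (auto simp: order_ge_def)
  then have "v * g = 0" by (rule component_eq_0_imp)
  then show False using V(3) by (simp add: annihilator_def)
qed

lemma dim_zero: "dim {0} = 0"
  using dim_le_card[of "{0}" "{}"] by simp

text \<open>Induction on \<open>dim V\<close>. For a prime \<open>P\<close> missing some
  \<open>v\<close> in \<open>V\<close>, put \<open>V0 = V \<inter> P\<close> and compare with
  \<open>E = R 1 * V0 + x * V\<close>, where \<open>x\<close> is a linear form outside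
  \<open>P\<close>. If \<open>V0\<close> is nonzero, its own growth passes to \<open>V\<close>. If
  \<open>V0\<close> is zero, equality of dimensions would give \<open>R 1 * V = x * V\<close>, which
  \<open>linear_forms_mult_not_subset\<close> excludes.\<close>

lemma dim_linear_forms_mult:
  assumes reduced: "\<And>x::'r. x ^ 2 = 0 \<Longrightarrow> x = 0" and depth: "depth \<ge> 2"
    and "subspace V" "V \<subseteq> R t" "V \<noteq> {0}"
  shows "dim V < dim (span {y * w |y w. y \<in> R 1 \<and> w \<in> V})"
  using assms(3-)
proof (induction "dim V" arbitrary: V rule: less_induct)
  case less
  define prods where "prods V = span {y * w |y w. y \<in> R 1 \<and> w \<in> V}" for V
  have finV: "fin_dim V" using less.prems fin_dim_component fin_dim_subset by blast
  have prods_sub: "prods V \<subseteq> R (Suc t)"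
    unfolding prods_def using less.prems mult_component[of _ 1 _ t]
    by (intro span_minimal subspace_component) auto
  have fin_prods: "fin_dim (prods V)"
    using fin_dim_component prods_sub by (rule fin_dim_subset)
  obtain v where v: "v \<in> V" "v \<noteq> 0" using less.prems subspace_0 by blast
  obtain h where h: "is_prime_ideal (annihilator {v * h})" "v \<notin> annihilator {v * h}"
    by (rule annihilator_prime[OF reduced v(2)])
  define g where "g = v * h"
  define P where "P = annihilator {g}"
  have P: "is_prime_ideal P" "v \<notin> P" "is_ideal P" "subspace P"
    using h ideal_annihilator ideal_imp_subspace by (auto simp: P_def g_def)
  \<comment> \<open>Otherwise all of \<open>maximal_ideal\<close>, including a nonzerodivisor, would
    annihilate \<open>g\<close>.\<close>
  have "\<not> R 1 \<subseteq> P"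
  proof
    assume R1: "R 1 \<subseteq> P"
    have Suc_sub: "R (Suc k) \<subseteq> P" for k
      unfolding component_Suc using R1 ideal.subspace_scale[OF P(3)] P(4)
      by (intro span_minimal) (auto simp: mult.commute)
    have "(\<Union>t\<in>{1..}. R t) \<subseteq> P" by (auto simp: Suc_le_eq gr0_conv_Suc dest: subsetD[OF Suc_sub])
    then have "maximal_ideal \<subseteq> P" unfolding maximal_ideal_def using P(4) by (rule span_minimal)
    moreover obtain a where "a \<in> maximal_ideal" "\<And>r. r * a = 0 \<Longrightarrow> r = 0"
      using depth_ge_2[OF depth] by metis
    ultimately have "g = 0" by (auto simp: P_def annihilator_def mult.commute)
    then show False using P(2) by (simp add: P_def annihilator_def)
  qed
  then obtain x where x: "x \<in> R 1" "x \<notin> P" by blast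
  define V0 where "V0 = V \<inter> P"
  have V0: "subspace V0" "V0 \<subseteq> V" "V0 \<subseteq> R t" "v \<notin> V0"
    using less.prems P by (auto simp: V0_def intro: subspace_inter)
  have prods_V0: "prods V0 \<subseteq> P" "prods V0 \<subseteq> prods V" "subspace (prods V0)"
  proof -
    show "prods V0 \<subseteq> P"
      unfolding prods_def V0_def using ideal.subspace_scale[OF P(3)]
      by (intro span_minimal P(4)) auto
    show "prods V0 \<subseteq> prods V"
      unfolding prods_def V0_def by (rule span_mono) auto
    show "subspace (prods V0)" by (simp add: prods_def)
  qed
  have fin0: "fin_dim (prods V0)" using fin_prods prods_V0(2) by (rule fin_dim_subset)
  define E where "E = {p + q |p q. p \<in> prods V0 \<and> q \<in> (*) x ` V}"
  have E: "subspace E"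
    unfolding E_def using prods_V0(3) less.prems(1)
      module_hom.subspace_image[OF Vector_Spaces.linear.axioms(3)[OF linear_mult]]
    by (intro subspace_sums) auto
  have "E \<subseteq> prods V"
  proof -
    have "x * w \<in> prods V" if "w \<in> V" for w
      unfolding prods_def using x(1) that by (intro span_base) auto
    moreover have "subspace (prods V)" by (simp add: prods_def)
    ultimately show ?thesis
      unfolding E_def using prods_V0(2) by (auto intro!: subspace_add[of "prods V"])
  qed
  then have dimE: "dim E \<le> dim (prods V)" using fin_prods fin_dim_dim_mono by blast
  \<comment> \<open>\<open>prods V0\<close> lies in the prime \<open>P\<close> and \<open>x\<close>
    does not, so the kernel in the dimension count is contained in \<open>V0\<close>.\<close>
  have "{u \<in> V. x * u \<in> prods V0} \<subseteq> V0"
    using prods_V0(1) P(1) x(2) unfolding V0_def is_prime_ideal_def by blast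
  then have "dim {u \<in> V. x * u \<in> prods V0} \<le> dim V0"
    using fin_dim_subset[OF finV V0(2)] fin_dim_dim_mono by blast
  moreover have "dim E + dim {u \<in> V. x * u \<in> prods V0} = dim (prods V0) + dim V"
    unfolding E_def using linear_mult less.prems(1) prods_V0(3) finV fin0 by (rule dim_plus_image)
  ultimately have dims: "dim (prods V0) + dim V \<le> dim E + dim V0" by linarith
  show ?case
  proof (cases "V0 = {0}")
    case False
    have "dim V0 < dim V"
      using fin_dim_dim_eq[OF finV V0(1,2)] V0(4) v(1) by (metis not_less)
    then have "dim V0 < dim (prods V0)"
      unfolding prods_def using V0 False by (intro less.hyps)
    then show ?thesis using dims dimE unfolding prods_def by linarith
  next
    case True
    show ?thesis
    proof (rule ccontr)
      assume "\<not> ?thesis"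
      then have "dim (prods V) \<le> dim V" by (simp add: prods_def)
      also have "\<dots> \<le> dim E" using dims True dim_zero by simp
      finally have "E = prods V"
        using fin_dim_dim_eq[OF fin_prods E \<open>E \<subseteq> prods V\<close>] by simp
      obtain y w where yw: "y \<in> R 1" "w \<in> V" "\<And>u. u \<in> V \<Longrightarrow> y * w - x * u \<notin> P"
        using linear_forms_mult_not_subset[OF depth less.prems(1) v(1), of g x] P x
        unfolding P_def by blast
      have "y * w \<in> E" unfolding \<open>E = prods V\<close> prods_def using yw by (intro span_base) auto
      then obtain p u where "p \<in> prods V0" "u \<in> V" "y * w = p + x * u" unfolding E_def by blast
      then show False using yw(3)[of u] prods_V0(1) by auto
    qed
  qed
qed

section \<open>Multiplicities with respect to the dimension of the ring\<close>

lemma hilbert_quotient_zero: "hilbert_quotient {0} t = dim (R t)"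
proof -
  have "R t \<inter> {0} = {0}" using zero_in_component by blast
  then show ?thesis using hilbert_quotient_eq[of "{0}" t] dim_zero by simp
qed

lemma prime_chain_bounded: "\<exists>k. \<forall>n (P :: nat \<Rightarrow> 'r set). prime_chain n P \<longrightarrow> n \<le> k"
proof (cases "{0} = (UNIV :: 'r set)")
  \<comment> \<open>The zero ring has no prime ideals, hence no chains.\<close>
  case True
  have "\<not> prime_chain n P" for n and P :: "nat \<Rightarrow> 'r set"
  proof
    assume "prime_chain n P"
    then have P: "is_ideal (P 0)" "P 0 \<noteq> UNIV" by (auto simp: prime_chain_def is_prime_ideal_def)
    have "UNIV \<subseteq> P 0" unfolding True[symmetric] using ideal.subspace_0[OF P(1)] by simp
    then show False using P(2) by blast
  qed
  then show ?thesis by blast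
next
  case False
  then obtain k c where "has_multiplicity (hilbert_quotient {0}) k (real c)"
    using exists_chain_has_multiplicity[OF homogeneous_ideal_zero] by blast
  then have "(\<lambda>t. fact k * real (\<Sum>i\<le>t. dim (R i)) / real t ^ k) \<longlonglongrightarrow> real c"
    by (simp add: has_multiplicity_def hilbert_quotient_zero)
  then have "Bseq (\<lambda>t. fact k * real (\<Sum>i\<le>t. dim (R i)) / real t ^ k)"
    by (rule Bseq_conv_Bfun[THEN iffD2, OF convergent_imp_Bseq[OF convergentI]])
  then obtain B where B: "\<And>t. \<bar>fact k * real (\<Sum>i\<le>t. dim (R i)) / real t ^ k\<bar> \<le> B"
    by (auto simp: Bseq_def)
  define C where "C = nat \<lceil>B\<rceil>"
  have bound: "(\<Sum>i\<le>t. dim (R i)) \<le> C * (t + 1) ^ k" for t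
  proof -
    \<comment> \<open>Evaluating the bound at \<open>t + 1\<close> keeps the denominator
      positive.\<close>
    let ?s = "\<Sum>i\<le>t + 1. dim (R i)"
    have "(\<Sum>i\<le>t. dim (R i)) \<le> ?s" by simp
    moreover have "real ?s \<le> fact k * real ?s"
      using mult_right_mono[OF fact_ge_1[of k] of_nat_0_le_iff[of ?s]] by (simp only: mult_1)
    moreover have "fact k * real ?s / real (t + 1) ^ k \<le> B" using B[of "t + 1"] by (rule abs_le_D1)
    then have "fact k * real ?s \<le> B * real (t + 1) ^ k" by (simp add: pos_divide_le_eq)
    moreover have "B * real (t + 1) ^ k \<le> real C * real (t + 1) ^ k"
      unfolding C_def by (intro mult_right_mono real_nat_ceiling_ge) simp
    ultimately have "real (\<Sum>i\<le>t. dim (R i)) \<le> real C * real (t + 1) ^ k" by linarith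
    then have "real (\<Sum>i\<le>t. dim (R i)) \<le> real (C * (t + 1) ^ k)" by simp
    then show ?thesis by (simp only: of_nat_le_iff)
  qed
  have "filtered_dim I t \<le> C * (t + 1) ^ k" for I t
    using filtered_dim_eq[of I t] dim_degree_le[of t] bound[of t] by linarith
  then show ?thesis using prime_chain_length_le by blast
qed

definition ring_dim :: nat
  where "ring_dim = the_enat (krull_dim TYPE('r))"

text \<open>Finiteness of the supremum makes \<open>the_enat\<close> return its actual
  value.\<close>

lemma prime_chain_le_ring_dim:
  assumes "prime_chain n (P :: nat \<Rightarrow> 'r set)"
  shows "n \<le> ring_dim"
proof -
  obtain k where k: "\<And>n (P :: nat \<Rightarrow> 'r set). prime_chain n P \<Longrightarrow> n \<le> k"
    using prime_chain_bounded by blast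
  have dim: "krull_dim TYPE('r) = Sup {enat n |n. \<exists>P :: nat \<Rightarrow> 'r set. prime_chain n P}"
    unfolding krull_dim_def prime_chain_def ..
  have "krull_dim TYPE('r) \<le> enat k"
    unfolding dim using k by (intro Sup_least) auto
  then obtain d where d: "krull_dim TYPE('r) = enat d" by (cases "krull_dim TYPE('r)") auto
  have "enat n \<le> krull_dim TYPE('r)"
    unfolding dim using assms by (intro Sup_upper) blast
  then show ?thesis by (simp add: ring_dim_def d)
qed

text \<open>A natural number, so that bounded monotone sequences of multiplicities stabilise. It is
  determined uniquely whenever it exists, as the value of a limit.\<close>

definition ideal_mult :: "'r set \<Rightarrow> nat"
  where "ideal_mult I = (SOME c. has_multiplicity (hilbert_quotient I) ring_dim (real c))"

lemma has_multiplicity_ideal_mult: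
  assumes "homogeneous_ideal I"
  shows "has_multiplicity (hilbert_quotient I) ring_dim (real (ideal_mult I))"
proof -
  have "\<exists>c. has_multiplicity (hilbert_quotient I) ring_dim (real c)"
  proof (cases "I = UNIV")
    case True
    then have "has_multiplicity (hilbert_quotient I) ring_dim (real 0)"
      by (simp add: has_multiplicity_def hilbert_quotient_UNIV)
    then show ?thesis by blast
  next
    case False
    then show ?thesis
      using exists_chain_has_multiplicity[OF assms] has_multiplicity_mono_degree prime_chain_le_ring_dim
      by blast
  qed
  then show ?thesis unfolding ideal_mult_def by (rule someI_ex)
qed

lemma multiplicity_hilbert_quotient:
  assumes "homogeneous_ideal I"
  shows "multiplicity TYPE('r) (hilbert_quotient I) = real (ideal_mult I)"
  using has_multiplicity_ideal_mult[OF assms]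
  unfolding multiplicity_def Let_def has_multiplicity_def ring_dim_def by (rule limI)

lemma multiplicity_hilbert: "multiplicity TYPE('r) hilbert = real (ideal_mult {0})"
proof -
  have "hilbert = hilbert_quotient {0}" by (auto simp: hilbert_def hilbert_quotient_zero)
  then show ?thesis using multiplicity_hilbert_quotient[OF homogeneous_ideal_zero] by simp
qed

lemma ideal_mult_antimono:
  assumes "homogeneous_ideal I" "homogeneous_ideal J" "I \<subseteq> J"
  shows "ideal_mult J \<le> ideal_mult I"
proof -
  have "hilbert_quotient J t \<le> hilbert_quotient I t" for t
  proof -
    have "dim (R t \<inter> I) \<le> dim (R t \<inter> J)"
      using fin_dim_component[of t] assms(3)
      by (intro fin_dim_dim_mono) (auto intro: fin_dim_subset)
    then show ?thesis
      using assms hilbert_quotient_eq[of I t] hilbert_quotient_eq[of J t]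
      by (simp add: homogeneous_ideal_def)
  qed
  then have "fact ring_dim * real (\<Sum>i\<le>t. hilbert_quotient J i) / real t ^ ring_dim
      \<le> fact ring_dim * real (\<Sum>i\<le>t. hilbert_quotient I i) / real t ^ ring_dim" for t
    by (intro divide_right_mono mult_left_mono of_nat_mono sum_mono) auto
  then have "real (ideal_mult J) \<le> real (ideal_mult I)"
    using has_multiplicity_ideal_mult[OF assms(1)] has_multiplicity_ideal_mult[OF assms(2)]
    unfolding has_multiplicity_def by (intro LIMSEQ_le) auto
  then show ?thesis by simp
qed

section \<open>The generalized minimum distance function\<close>

text \<open>The inserted 0 covers the empty family, for which the minimum distance is the
  multiplicity of the ring.\<close>

definition max_mult :: "nat \<Rightarrow> nat \<Rightarrow> nat"
  where "max_mult t l = Max (insert 0 ((\<lambda>F. ideal_mult (ideal_gen F)) ` gen_min_dist_family t l))"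

lemma homogeneous_family: "F \<in> gen_min_dist_family t l \<Longrightarrow> homogeneous_ideal (ideal_gen F)"
  unfolding gen_min_dist_family_def by (blast intro: homogeneous_ideal_gen)

lemma ideal_mult_le_ring:
  assumes "F \<in> gen_min_dist_family t l"
  shows "ideal_mult (ideal_gen F) \<le> ideal_mult {0}"
  by (intro ideal_mult_antimono homogeneous_ideal_zero homogeneous_family[OF assms])
     (simp add: ideal.span_zero)

lemma finite_family_mults: "finite ((\<lambda>F. ideal_mult (ideal_gen F)) ` gen_min_dist_family t l)"
  by (rule finite_subset[of _ "{..ideal_mult {0}}"]) (auto simp: ideal_mult_le_ring)

lemma max_mult_le: "max_mult t l \<le> ideal_mult {0}"
  unfolding max_mult_def using finite_family_mults by (auto simp: ideal_mult_le_ring)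

lemma gen_min_dist_eq: "gen_min_dist t l = real (ideal_mult {0}) - real (max_mult t l)"
proof (cases "gen_min_dist_family t l = {}")
  case True
  then show ?thesis by (simp add: gen_min_dist_def max_mult_def multiplicity_hilbert)
next
  case False
  let ?A = "(\<lambda>F. ideal_mult (ideal_gen F)) ` gen_min_dist_family t l"
  have "{multiplicity TYPE('r) (hilbert_quotient (ideal_gen F)) |F. F \<in> gen_min_dist_family t l} = real ` ?A"
    unfolding Setcompr_eq_image image_image
    by (rule image_cong) (simp_all add: multiplicity_hilbert_quotient homogeneous_family)
  moreover have "Max (real ` ?A) = real (Max ?A)"
    using False finite_family_mults by (intro mono_Max_commute[symmetric]) (auto simp: mono_def)
  moreover have "max_mult t l = Max ?A"
    unfolding max_mult_def using False finite_family_mults by (subst Max_insert) auto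
  ultimately show ?thesis using False by (simp add: gen_min_dist_def multiplicity_hilbert)
qed

text \<open>A smaller ideal has a larger quotient, hence at least the same multiplicity.\<close>

lemma max_mult_leI:
  assumes "\<And>F. F \<in> gen_min_dist_family t l \<Longrightarrow> \<exists>G\<in>gen_min_dist_family t' l'. ideal_gen G \<subseteq> ideal_gen F"
  shows "max_mult t l \<le> max_mult t' l'"
proof -
  have "ideal_mult (ideal_gen F) \<le> max_mult t' l'" if F: "F \<in> gen_min_dist_family t l" for F
  proof -
    obtain G where G: "G \<in> gen_min_dist_family t' l'" "ideal_gen G \<subseteq> ideal_gen F"
      using assms F by blast
    then have "ideal_mult (ideal_gen F) \<le> ideal_mult (ideal_gen G)"
      using F homogeneous_family by (intro ideal_mult_antimono)
    also have "\<dots> \<le> max_mult t' l'"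
      unfolding max_mult_def using G finite_family_mults by (intro Max_ge) auto
    finally show ?thesis .
  qed
  then show ?thesis unfolding max_mult_def[of t l] using finite_family_mults by auto
qed

lemma max_mult_antimono_card: "max_mult t (Suc l) \<le> max_mult t l"
proof (rule max_mult_leI)
  fix F assume F: "F \<in> gen_min_dist_family t (Suc l)"
  then obtain G where G: "G \<subseteq> F" "card G = l"
    using obtain_subset_with_card_n[of l F] by (auto simp: gen_min_dist_family_def)
  have "annihilator F \<subseteq> annihilator G" using G by (auto simp: annihilator_def)
  moreover have "0 \<in> annihilator F" by (simp add: annihilator_def)
  ultimately have "annihilator G \<noteq> {0}" using F by (auto simp: gen_min_dist_family_def)
  then have "G \<in> gen_min_dist_family t l"
    using F G independent_mono[OF _ G(1)] finite_subset[OF G(1)] order.trans[OF G(1)]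
    by (simp add: gen_min_dist_family_def)
  then show "\<exists>G\<in>gen_min_dist_family t l. ideal_gen G \<subseteq> ideal_gen F"
    using G ideal.span_mono by blast
qed

lemma max_mult_le_Suc_Suc:
  assumes reduced: "\<And>x::'r. x ^ 2 = 0 \<Longrightarrow> x = 0" and depth: "depth \<ge> 2" and "l \<ge> 1"
  shows "max_mult t l \<le> max_mult (Suc t) (Suc l)"
proof (rule max_mult_leI)
  fix F assume "F \<in> gen_min_dist_family t l"
  then have F: "F \<subseteq> R t" "finite F" "card F = l" "independent F" "annihilator F \<noteq> {0}"
    by (auto simp: gen_min_dist_family_def)
  let ?W = "span {y * w |y w. y \<in> R 1 \<and> w \<in> span F}"
  have dimF: "dim (span F) = l" using F dim_span_eq_card_independent by simp
  then have nonzero: "span F \<noteq> {0}" using assms(3) dim_zero by (metis not_one_le_zero)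
  have spanF: "span F \<subseteq> R t" using F by (intro span_minimal subspace_component)
  have "dim (span F) < dim ?W"
    using reduced depth subspace_span spanF nonzero by (rule dim_linear_forms_mult)
  then have dimW: "l < dim ?W" unfolding dimF .
  \<comment> \<open>Strict growth provides at least \<open>Suc l\<close> independent elements of
    degree \<open>Suc t\<close>. They lie in the ideal generated by \<open>F\<close>, so whatever
    annihilates \<open>F\<close> annihilates them.\<close>
  obtain B where B: "B \<subseteq> ?W" "independent B" "?W \<subseteq> span B" "card B = dim ?W"
    by (rule basis_exists)
  obtain G where G: "G \<subseteq> B" "card G = Suc l" "finite G"
    using obtain_subset_with_card_n[of "Suc l" B] dimW B by auto
  have WR: "?W \<subseteq> R (Suc t)"
    using spanF mult_component[of _ 1 _ t] by (intro span_minimal subspace_component) auto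
  have "span F \<subseteq> ideal_gen F"
    using ideal.span_superset by (intro span_minimal ideal_imp_subspace) auto
  then have "?W \<subseteq> ideal_gen F"
    using ideal.span_scale by (intro span_minimal ideal_imp_subspace) auto
  then have GF: "G \<subseteq> ideal_gen F" using G B by blast
  then have "annihilator F \<subseteq> annihilator G"
    using annihilator_ideal_gen[of F] by (auto simp: annihilator_def)
  moreover have "0 \<in> annihilator F" by (simp add: annihilator_def)
  ultimately have "annihilator G \<noteq> {0}" using F by auto
  then have "G \<in> gen_min_dist_family (Suc t) (Suc l)"
    using G B WR independent_mono[OF B(2) G(1)] by (auto simp: gen_min_dist_family_def)
  moreover have "ideal_gen G \<subseteq> ideal_gen F" using GF by (intro ideal.span_minimal) auto
  ultimately show "\<exists>G\<in>gen_min_dist_family (Suc t) (Suc l). ideal_gen G \<subseteq> ideal_gen F" by blast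
qed

end

lemma mono_bounded_nat_eventually_const:
  fixes f :: "nat \<Rightarrow> nat"
  assumes "mono f" "\<And>t. f t \<le> B"
  obtains N where "\<And>t. t \<ge> N \<Longrightarrow> f t = f N"
proof -
  have fin: "finite (range f)" by (rule finite_subset[of _ "{..B}"]) (use assms in auto)
  then have "Max (range f) \<in> range f" by (intro Max_in) auto
  then obtain N where N: "f N = Max (range f)" by (metis imageE)
  have "f t = f N" if "t \<ge> N" for t
    using monoD[OF assms(1) that] N fin by (intro antisym) auto
  then show thesis by (rule that)
qed

theorem theorem2:
  fixes scale :: "'k::field \<Rightarrow> 'r::comm_ring_1 \<Rightarrow> 'r"
    and R :: "nat \<Rightarrow> 'r set"
    and l :: nat
  assumes "standard_graded_algebra scale R"
    and reduced: "\<And>(x::'r) n. x ^ n = 0 \<Longrightarrow> x = 0"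
    and "standard_graded_algebra.depth scale R \<ge> 2"
    and "l \<ge> 1"
  shows "standard_graded_algebra.reg_index scale R (l + 1)
    \<le> standard_graded_algebra.reg_index scale R l + 1"
proof -
  interpret standard_graded_algebra scale R by (rule assms(1))
  have up: "max_mult t j \<le> max_mult (Suc t) (Suc j)" if "j \<ge> 1" for t j
    using max_mult_le_Suc_Suc[of j t] reduced assms(3) that by blast
  \<comment> \<open>Going up in both arguments and then dropping one element gives monotonicity in
    \<open>t\<close> alone.\<close>
  have mono: "mono (\<lambda>t. max_mult t j)" if "j \<ge> 1" for j
    using up[OF that] max_mult_antimono_card order.trans by (subst mono_iff_le_Suc) blast
  have "\<exists>N. \<forall>t\<ge>N. max_mult t j = max_mult N j" if "j \<ge> 1" for j
    using mono_bounded_nat_eventually_const[OF mono[OF that] max_mult_le] by metis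
  then obtain N where N: "\<And>j t. j \<ge> 1 \<Longrightarrow> t \<ge> N j \<Longrightarrow> max_mult t j = max_mult (N j) j"
    by metis
  define M where "M j = max_mult (N j) j" for j
  have le_M: "max_mult t j \<le> M j" if "j \<ge> 1" for t j
    using monoD[OF mono[OF that], of t "max t (N j)"] N[OF that, of "max t (N j)"] by (simp add: M_def)
  \<comment> \<open>The minimum distance is a constant minus \<open>max_mult\<close>, so both
    stabilise at the same index.\<close>
  have reg: "reg_index j = (LEAST t. max_mult t j = M j)" if j: "j \<ge> 1" for j
  proof -
    have "gen_min_dist t j = real (ideal_mult {0}) - real (M j)" if "t \<ge> N j" for t
      unfolding gen_min_dist_eq M_def N[OF j that] ..
    then have "\<forall>\<^sub>F t in sequentially. gen_min_dist t j = real (ideal_mult {0}) - real (M j)"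
      unfolding eventually_sequentially by blast
    then have "stab_value j = real (ideal_mult {0}) - real (M j)"
      unfolding stab_value_def by (intro limI tendsto_eventually)
    then show ?thesis by (simp add: reg_index_def gen_min_dist_eq)
  qed
  \<comment> \<open>The values are squeezed: \<open>M l\<close> is attained at the regularity index
    of \<open>l\<close>, hence is at most the value for \<open>Suc l\<close> one degree later, which
    is at most \<open>M (Suc l)\<close> and so at most \<open>M l\<close>.\<close>
  have "M (Suc l) \<le> M l"
    using le_M[OF assms(4)] max_mult_antimono_card order.trans unfolding M_def[of "Suc l"] by blast
  moreover have attained: "max_mult (reg_index l) l = M l"
    unfolding reg[OF assms(4)] by (rule LeastI[of _ "N l"]) (simp add: M_def)
  moreover have "max_mult (reg_index l) l \<le> max_mult (Suc (reg_index l)) (Suc l)"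
    by (rule up[OF assms(4)])
  moreover have "max_mult (Suc (reg_index l)) (Suc l) \<le> M (Suc l)"
    by (rule le_M) simp
  ultimately have "max_mult (Suc (reg_index l)) (Suc l) = M (Suc l)" by linarith
  then show ?thesis using reg[of "Suc l"] by (auto intro: Least_le)
qed

end
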